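(* Let $k\ge 2$ be an integer, let $\mathcal{H}$ be an affine hyperplane in $\mathbb{R}^k$ with normal vector $(1,\alpha_2,\ldots,\alpha_k)$, and let $\mu$ be the induced Lebesgue probability measure on $\mathcal{H}\cap[0,1)^k$. Let $\psi:\mathbb{N}\to[0,1)$ satisfy $\sum_{n=1}^\infty \psi(n)(\log n)^{k-1}<\infty$, and let $\mathbf{y}\in\mathbb{R}^k$. Put $\ell = 1 + \#\{2\le i\le k: \alpha_i\ne 0\}$ and assume that \[ \omega(\alpha_2,\ldots,\alpha_k) < \ell. \] Then $\mu(W_k^\times(\psi,\mathbf{y}))=0$.
   Context: For $x \in \mathbb{R}$, $\|x\|$ denotes the distance from $x$ to the nearest integer. For $\psi:\mathbb{N}\to[0,1)$ and $\mathbf{y}\in\mathbb{R}^k$, $W_k^\times(\psi,\mathbf{y})$ is the set of $\mathbf{x}\in[0,1)^k$ such that $\|nx_1-y_1\|\cdots\|nx_k-y_k\|<\psi(n)$ holds for infinitely many $n\in\mathbb{N}$. The simultaneous exponent of $\mathbf{x}=(x_1,\ldots,x_d)\in\mathbb{R}^d$ is $\omega(\mathbf{x})=\sup\{w: \max\{\|nx_1\|,\ldots,\|nx_d\|\}<n^{-w}\text{ for infinitely many } n\in\mathbb{N}\}$. *)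

theory Defs
  imports "HOL-Probability.Probability"
begin

definition nint_dist :: "real \<Rightarrow> real" where
  "nint_dist x = \<bar>x - of_int (round x)\<bar>"

lemma nint_dist_eq_infdist: "nint_dist x = infdist x \<int>"
proof -
  have "infdist x \<int> \<le> nint_dist x"
    using infdist_le[of "of_int (round x)" \<int> x] by (simp add: nint_dist_def dist_real_def)
  moreover have "nint_dist x \<le> infdist x \<int>"
  proof -
    have "nint_dist x \<le> dist x a" if "a \<in> \<int>" for a
      using that round_diff_minimal[of x] by (auto elim!: Ints_cases simp: nint_dist_def dist_real_def)
    then show ?thesis
      unfolding infdist_def by (auto intro!: cINF_greatest)
  qed
  ultimately show ?thesis by simp
qed

definition unit_cube :: "(real ^ 'n) set" where
  "unit_cube = {x. \<forall>i. 0 \<le> x $ i \<and> x $ i < 1}"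

definition W_mult :: "(nat \<Rightarrow> real) \<Rightarrow> real ^ 'n \<Rightarrow> (real ^ 'n) set" where
  "W_mult \<psi> y = {x \<in> unit_cube.
     \<exists>\<^sub>\<infinity>n. n \<ge> 1 \<and> (\<Prod>i\<in>UNIV. nint_dist (real n * x $ i - y $ i)) < \<psi> n}"

text \<open>The supremum is taken in \<^typ>\<open>ereal\<close>, since the exponent may be infinite.\<close>

definition simult_exponent :: "real ^ 'd \<Rightarrow> ereal" where
  "simult_exponent x = Sup {ereal w | w.
     \<exists>\<^sub>\<infinity>n. n \<ge> 1 \<and> (MAX i. nint_dist (real n * x $ i)) < real n powr (- w)}"

text \<open>
  The space of dimension k is modelled as \<open>real ^ 'm option\<close> where \<open>'m\<close> has k - 1 elements:
  the index \<^term>\<open>None\<close> is the first coordinate, and the indices \<open>Some j\<close> are the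
  coordinates 2, ..., k.
\<close>

definition normal_vec :: "real ^ ('m::finite) \<Rightarrow> real ^ 'm option" where
  "normal_vec \<alpha> = (\<chi> i. case i of None \<Rightarrow> 1 | Some j \<Rightarrow> \<alpha> $ j)"

text \<open>
  Lebesgue measure of dimension k - 1 on a hyperplane H, extended by zero to the whole space: the
  image of Lebesgue measure under an isometry onto H. Such an isometry exists
  (\<open>ex_hyperplane_isometry\<close>), and the measure does not depend on its choice
  (\<open>hyperplane_lborel_eq\<close>).
\<close>

definition hyperplane_lborel :: "(real ^ ('m::finite) option) set \<Rightarrow> (real ^ 'm option) measure" where
  "hyperplane_lborel H = distr lborel borel
     (SOME f :: real ^ 'm \<Rightarrow> real ^ 'm option. range f = H \<and> (\<forall>u v. dist (f u) (f v) = dist u v))"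

text \<open>
  If H meets the unit cube in a set of measure zero, there is no probability measure to speak of,
  and the measure below is the null measure.
\<close>

definition induced_prob :: "(real ^ ('m::finite) option) set \<Rightarrow> (real ^ 'm option) measure" where
  "induced_prob H = uniform_measure (hyperplane_lborel H) (H \<inter> unit_cube)"

lemma ex_hyperplane_isometry:
  fixes a :: "real ^ ('m::finite) option"
  assumes "a \<noteq> 0"
  shows "\<exists>f :: real ^ 'm \<Rightarrow> real ^ 'm option.
           range f = {x. a \<bullet> x = c} \<and> (\<forall>u v. dist (f u) (f v) = dist u v)"
proof -
  have "dim (UNIV :: (real ^ 'm) set) = dim {x. a \<bullet> x = 0}"
    using assms by (simp add: dim_hyperplane card_UNIV_option)
  then obtain g :: "real ^ ('m::finite) \<Rightarrow> real ^ 'm option"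
    where g: "linear g" "range g = {x. a \<bullet> x = 0}" "\<And>x. norm (g x) = norm x"
    using isometries_subspaces[of "UNIV :: (real ^ 'm) set" "{x. a \<bullet> x = 0}"]
    by (metis UNIV_I subspace_UNIV subspace_hyperplane)
  define p where "p = (c / (a \<bullet> a)) *\<^sub>R a"
  have p: "a \<bullet> p = c"
    using assms by (simp add: p_def)
  have "range (\<lambda>u. p + g u) = (+) p ` range g"
    by (simp add: image_image)
  also have "\<dots> = {x. a \<bullet> x = c}"
  proof -
    have "x \<in> (+) p ` {x. a \<bullet> x = 0}" if "a \<bullet> x = c" for x
      using that p by (intro image_eqI[where x = "x - p"]) (auto simp: inner_diff_right)
    then show ?thesis
      using p by (auto simp: g inner_add_right)
  qed
  finally have "range (\<lambda>u. p + g u) = {x. a \<bullet> x = c}" .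
  moreover have "dist (p + g u) (p + g v) = dist u v" for u v
    using g(1,3) by (simp add: dist_norm flip: linear_diff)
  ultimately show ?thesis
    by (intro exI[where x = "\<lambda>u. p + g u"]) blast
qed

lemma isometry_borel_measurable:
  fixes f :: "'a::euclidean_space \<Rightarrow> 'b::euclidean_space"
  assumes "\<And>u v. dist (f u) (f v) = dist u v"
  shows "f \<in> borel_measurable borel"
proof -
  have "continuous_on UNIV f"
    unfolding continuous_on_iff using assms by auto
  then show ?thesis
    by (rule borel_measurable_continuous_onI)
qed

lemma lborel_distr_isometry:
  fixes h :: "'a::euclidean_space \<Rightarrow> 'a"
  assumes h: "\<And>u v. dist (h u) (h v) = dist u v"
  shows "distr lborel borel h = lborel"
proof -
  define T where "T = (\<lambda>x. h x - h 0)"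
  have "orthogonal_transformation T"
    using h by (auto simp: orthogonal_transformation_isometry T_def dist_norm)
  then have "bij T"
    by (rule orthogonal_transformation_bij)
  moreover have "bij (\<lambda>x. x + h 0)"
    by (rule bij_betw_byWitness[where f' = "\<lambda>x. x - h 0"]) auto
  ultimately have "bij ((\<lambda>x. x + h 0) \<circ> T)"
    by (rule bij_comp)
  then have bh: "bij h"
    by (simp add: T_def comp_def)
  define g where "g = inv h"
  have hg [simp]: "h (g x) = x" "g (h x) = x" for x
    using bh by (simp_all add: g_def bij_is_surj surj_f_inv_f bij_is_inj)
  have g: "dist (g u) (g v) = dist u v" for u v
    using h[of "g u" "g v"] by simp
  have hb [measurable]: "h \<in> borel_measurable borel"
    using h by (rule isometry_borel_measurable)
  have vimage: "h -` X = g ` X" for X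
    using bh by (simp add: g_def bij_vimage_eq_inv_image)
  define \<nu> where "\<nu> = distr lborel borel h"
  have [measurable_cong, simp]: "sets \<nu> = sets borel"
    by (simp add: \<nu>_def)
  have emb: "emeasure \<nu> X = emeasure lborel (h -` X)" if "X \<in> sets borel" for X
    using that by (simp add: \<nu>_def emeasure_distr)
  have ball: "emeasure \<nu> (ball a r) = emeasure lborel (ball a r)" for a r
  proof (cases "r \<ge> 0")
    case True
    have "h -` ball a r = ball (g a) r"
      using h[of "g a"] by (auto simp: set_eq_iff)
    then show ?thesis
      using True by (simp add: emb emeasure_ball)
  next
    case False
    then show ?thesis by (simp add: ball_empty)
  qed
  have null: "emeasure \<nu> N = 0" if N: "negligible N" "N \<in> sets borel" for N
  proof -
    have "negligible (g ` N)"
    proof (rule negligible_locally_Lipschitz_image[OF _ N(1)])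
      fix x assume "x \<in> N"
      show "\<exists>U B. open U \<and> x \<in> U \<and> (\<forall>y\<in>N \<inter> U. norm (g y - g x) \<le> B * norm (y - x))"
        using g by (intro exI[where x = UNIV] exI[where x = 1]) (auto simp: dist_norm)
    qed simp
    moreover have "g ` N \<in> sets borel"
      using measurable_sets[OF hb N(2)] by (simp add: vimage)
    ultimately show ?thesis
      using N(2) by (auto simp: emb vimage negligible_iff_null_sets null_sets_completion_iff)
  qed
  have eq: "emeasure \<nu> U = emeasure lborel U" if "open U" for U
  proof -
    define K where "K = {(a, r). 0 < r \<and> ball a r \<subseteq> U}"
    have "\<exists>i. i \<in> K \<and> x \<in> ball (fst i) (snd i) \<and> snd i < d" if "x \<in> U" "0 < d" for x d
    proof -
      obtain e where e: "e > 0" "ball x e \<subseteq> U"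
        using \<open>open U\<close> \<open>x \<in> U\<close> openE by blast
      have "ball x (min e (d / 2)) \<subseteq> U"
        using e(2) by auto
      then show ?thesis
        using e(1) \<open>0 < d\<close> by (intro exI[where x = "(x, min e (d / 2))"]) (auto simp: K_def)
    qed
    then obtain C where C: "countable C" "C \<subseteq> K"
      "pairwise (\<lambda>i j. disjnt (ball (fst i) (snd i)) (ball (fst j) (snd j))) C"
      "negligible (U - (\<Union>i\<in>C. ball (fst i) (snd i)))"
      using Vitali_covering_theorem_balls[of U K fst snd] by blast
    define V where "V = (\<Union>i\<in>C. ball (fst i) (snd i))"
    have V: "V \<subseteq> U" "V \<in> sets borel" "negligible (U - V)"
    proof -
      show "V \<subseteq> U"
        using C(2) unfolding V_def K_def by fastforce
      show "V \<in> sets borel"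
        unfolding V_def by (intro borel_open) auto
      show "negligible (U - V)"
        using C(4) unfolding V_def .
    qed
    have U: "U \<in> sets borel" using \<open>open U\<close> by simp
    have d: "disjoint_family_on (\<lambda>i. ball (fst i) (snd i)) C"
      using C(3) by (auto simp: disjoint_family_on_def pairwise_def disjnt_def)
    have split: "emeasure M U = emeasure M V + emeasure M (U - V)" if "sets M = sets borel" for M
      using that U V by (subst plus_emeasure) (auto intro!: arg_cong[where f = "emeasure M"])
    have "emeasure \<nu> V = emeasure lborel V"
      unfolding V_def using C(1) d by (subst (1 2) emeasure_UN_countable) (auto simp: ball)
    moreover have "emeasure lborel (U - V) = 0"
      using V(2,3) U by (auto simp: negligible_iff_null_sets null_sets_completion_iff)
    moreover have "emeasure \<nu> (U - V) = 0"
      using V(2,3) U by (intro null) auto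
    ultimately show ?thesis
      using split[of \<nu>] split[of lborel] by simp
  qed
  have "lborel = \<nu>"
    by (rule lborel_eqI) (simp_all add: eq[OF open_box] emeasure_lborel_box)
  then show ?thesis by (simp add: \<nu>_def)
qed

lemma hyperplane_lborel_eq:
  fixes f :: "real ^ ('m::finite) \<Rightarrow> real ^ 'm option"
  assumes "range f = H" "\<And>u v. dist (f u) (f v) = dist u v"
  shows "hyperplane_lborel H = distr lborel borel f"
proof -
  define g where "g = (SOME f :: real ^ 'm \<Rightarrow> real ^ 'm option.
    range f = H \<and> (\<forall>u v. dist (f u) (f v) = dist u v))"
  have "range g = H \<and> (\<forall>u v. dist (g u) (g v) = dist u v)"
    unfolding g_def by (rule someI[of _ f]) (use assms in blast)
  then have g: "range g = H" "\<And>u v. dist (g u) (g v) = dist u v" by auto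
  define h where "h = (\<lambda>u. inv g (f u))"
  have gh: "g (h u) = f u" for u
    unfolding h_def by (rule f_inv_into_f) (use g(1) assms(1) in blast)
  have h: "dist (h u) (h v) = dist u v" for u v
    using g(2)[of "h u" "h v"] by (simp add: gh assms(2))
  have [measurable]: "g \<in> borel_measurable borel" "h \<in> borel_measurable borel"
    using g(2) h by (auto intro: isometry_borel_measurable)
  have "distr lborel borel f = distr (distr lborel borel h) borel g"
    by (subst distr_distr) (auto simp: gh comp_def)
  also have "\<dots> = hyperplane_lborel H"
    by (simp add: lborel_distr_isometry[OF h] hyperplane_lborel_def g_def)
  finally show ?thesis ..
qed

lemma sets_unit_cube [measurable]: "unit_cube \<in> sets borel"
  unfolding unit_cube_def by measurable

lemma bounded_unit_cube: "bounded unit_cube"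
  by (rule bounded_subset[OF bounded_cbox[of 0 1]])
    (auto simp: unit_cube_def mem_box_cart less_imp_le)

lemma prob_space_induced_prob:
  fixes a :: "real ^ ('m::finite) option"
  assumes "a \<noteq> 0" "H = {x. a \<bullet> x = c}"
    and "emeasure (hyperplane_lborel H) (H \<inter> unit_cube) \<noteq> 0"
  shows "prob_space (induced_prob H)"
proof -
  obtain f :: "real ^ ('m::finite) \<Rightarrow> real ^ 'm option"
    where f: "range f = H" "\<And>u v. dist (f u) (f v) = dist u v"
    using ex_hyperplane_isometry[OF assms(1), of c] assms(2) by auto
  have [measurable]: "f \<in> borel_measurable borel"
    using f(2) by (rule isometry_borel_measurable)
  have [measurable]: "H \<in> sets borel"
    unfolding assms(2) by (intro borel_closed closed_hyperplane)
  have "bounded (f -` (H \<inter> unit_cube))"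
  proof -
    obtain B where "\<And>x y. x \<in> unit_cube \<Longrightarrow> y \<in> unit_cube \<Longrightarrow>
        dist (x :: real ^ 'm option) y \<le> B"
      using bounded_unit_cube bounded_two_points by metis
    then have "\<forall>x\<in>f -` (H \<inter> unit_cube). \<forall>y\<in>f -` (H \<inter> unit_cube). dist x y \<le> B"
      by (metis IntE f(2) vimageE)
    then show ?thesis
      by (subst bounded_two_points) blast
  qed
  then have "emeasure lborel (f -` (H \<inter> unit_cube)) < \<infinity>"
    by (rule emeasure_bounded_finite)
  then have "emeasure (hyperplane_lborel H) (H \<inter> unit_cube) \<noteq> \<infinity>"
    by (simp add: hyperplane_lborel_eq[OF f] emeasure_distr)
  then show ?thesis
    unfolding induced_prob_def using assms(3) by (intro prob_space_uniform_measure)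
qed

end

theory Submission
  imports Defs "HOL-Real_Asymp.Real_Asymp"
begin

text \<open>
  Parametrise the hyperplane by the last k - 1 coordinates and equip the parameter space with the
  standard Gaussian measure, which has the same null sets as Lebesgue measure and a rapidly decaying
  characteristic function. The set where the product of the distances is less than a given bound
  of order \<open>2\<^sup>-\<^sup>L\<close> is covered by \<open>O(L ^ (k - 1))\<close> boxes \<open>\<parallel>n x\<^sub>i - y\<^sub>i\<parallel> \<le> 1 / (8 N\<^sub>i)\<close>
  whose \<open>N\<^sub>i\<close> have product \<open>2\<^sup>L\<close>. Each box is majorised by a product of Fejer kernels;
  its zero frequency contributes the expected measure, of order \<open>2\<^sup>-\<^sup>L\<close>. A nonzero frequency d
  contributes at most \<open>exp (- 2 pi\<^sup>2 n\<^sup>2 |D|\<^sup>2)\<close>, where D has the entries \<open>d\<^sub>j - d\<^sub>1 \<alpha>\<^sub>j\<close>.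
  The smallest \<open>N\<^sub>i\<close> over \<open>i = 1\<close> and the \<open>l - 1\<close> indices with
  nonzero \<open>\<alpha>\<^sub>i\<close> is at most \<open>2 ^ (L / l)\<close>, which forces either \<open>d\<^sub>1 = O(2 ^ (L / l))\<close> or D bounded
  away from 0. The exponent hypothesis gives \<open>|D| \<ge> n ^ (- 1 + \<eta>)\<close> with \<open>\<eta> > 0\<close> as long as \<open>2\<^sup>L \<le> n ^ (1 + e)\<close>,
  so the nonzero frequencies are negligible. The constraint on L is harmless, because \<open>\<psi> n\<close> may be
  enlarged to at least \<open>n ^ (- 1 - e)\<close>, and the Borel-Cantelli lemma concludes.
\<close>

subsection \<open>The Gaussian measure\<close>

lemma measurable_vec_lambda_PiM [measurable]:
  "(\<lambda>f. \<chi> i. f i) \<in> borel_measurable (PiM UNIV (\<lambda>_::'m::finite. lborel :: real measure))"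
  by (subst borel_measurable_iff_halfspace_le) (auto simp: Basis_vec_def inner_axis)

text \<open>This makes Fubini for finite product measures available on vectors. Agreement on open
  boxes suffices, where both measures give the product of the side lengths.\<close>

lemma lborel_vec_eq_distr_PiM:
  "(lborel :: (real ^ 'm::finite) measure) =
     distr (PiM UNIV (\<lambda>_::'m. lborel :: real measure)) borel (\<lambda>f. \<chi> i. f i)"
proof (rule lborel_eqI)
  interpret product_sigma_finite "\<lambda>_::'m. lborel :: real measure"
    by standard
  fix l u :: "real ^ 'm"
  assume le: "\<And>b. b \<in> Basis \<Longrightarrow> l \<bullet> b \<le> u \<bullet> b"
  have le': "l $ i \<le> u $ i" for i
    using le[of "axis i 1"] by (simp add: inner_axis)
  have "emeasure (distr (PiM UNIV (\<lambda>_::'m. lborel)) borel (\<lambda>f. \<chi> i. f i)) (box l u)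
      = emeasure (PiM UNIV (\<lambda>_::'m. lborel)) (PiE UNIV (\<lambda>i. {l $ i<..<u $ i}))"
    by (subst emeasure_distr)
       (auto simp: mem_box_cart space_PiM PiE_def extensional_def Pi_iff intro!: arg_cong2[where f = emeasure])
  also have "\<dots> = (\<Prod>i\<in>UNIV. ennreal (u $ i - l $ i))"
    by (subst emeasure_PiM) (auto simp: le')
  also have "\<dots> = ennreal (\<Prod>i\<in>UNIV. u $ i - l $ i)"
    by (rule prod_ennreal) (simp add: le')
  also have "(\<Prod>i\<in>UNIV. u $ i - l $ i) = (\<Prod>b\<in>Basis. (u - l) \<bullet> b)"
    by (simp add: Basis_vec_def UNION_singleton_eq_range prod.reindex inj_on_def axis_eq_axis inner_axis)
  finally show "emeasure (distr (PiM UNIV (\<lambda>_::'m. lborel)) borel (\<lambda>f. \<chi> i. f i)) (box l u)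
      = ennreal (\<Prod>b\<in>Basis. (u - l) \<bullet> b)" .
qed simp

lemma
  fixes g :: "'m::finite \<Rightarrow> real \<Rightarrow> complex"
  assumes g: "\<And>i. integrable lborel (g i)"
  shows integral_lborel_prod_vec:
      "(\<integral>x. (\<Prod>i\<in>UNIV. g i (x $ i)) \<partial>(lborel :: (real ^ 'm) measure)) = (\<Prod>i\<in>UNIV. \<integral>t. g i t \<partial>lborel)"
    and integrable_lborel_prod_vec:
      "integrable (lborel :: (real ^ 'm) measure) (\<lambda>x. \<Prod>i\<in>UNIV. g i (x $ i))"
proof -
  interpret product_sigma_finite "\<lambda>_::'m. lborel :: real measure"
    by standard
  have [measurable]: "g i \<in> borel_measurable borel" for i
    using borel_measurable_integrable[OF g[of i]] by simp
  have [measurable]: "(\<lambda>x :: real ^ 'm. \<Prod>i\<in>UNIV. g i (x $ i)) \<in> borel_measurable borel"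
    by measurable
  show "(\<integral>x. (\<Prod>i\<in>UNIV. g i (x $ i)) \<partial>(lborel :: (real ^ 'm) measure)) = (\<Prod>i\<in>UNIV. \<integral>t. g i t \<partial>lborel)"
    unfolding lborel_vec_eq_distr_PiM
    by (subst integral_distr) (auto simp: product_integral_prod[OF _ g])
  show "integrable (lborel :: (real ^ 'm) measure) (\<lambda>x. \<Prod>i\<in>UNIV. g i (x $ i))"
    unfolding lborel_vec_eq_distr_PiM
    by (subst integrable_distr_eq) (auto simp: product_integrable_prod[OF _ g])
qed

definition vec_normal_density :: "real ^ ('m::finite) \<Rightarrow> real" where
  "vec_normal_density x = (\<Prod>i\<in>UNIV. std_normal_density (x $ i))"

definition vec_normal :: "(real ^ ('m::finite)) measure" where
  "vec_normal = density lborel (\<lambda>x. ennreal (vec_normal_density x))"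

lemma measurable_vec_normal_density [measurable]:
  "vec_normal_density \<in> borel_measurable borel"
  unfolding vec_normal_density_def by measurable

lemma vec_normal_density_pos: "0 < vec_normal_density x"
  by (auto simp: vec_normal_density_def intro!: prod_pos normal_density_pos)

lemma sets_vec_normal [simp, measurable_cong]: "sets vec_normal = sets borel"
  by (simp add: vec_normal_def)

lemma space_vec_normal [simp]: "space vec_normal = UNIV"
  by (simp add: vec_normal_def)

text \<open>Because the density is positive everywhere, almost-sure statements proved with the
  Gaussian transfer to Lebesgue measure.\<close>

lemma AE_vec_normal_iff: "(AE x in vec_normal. P x) \<longleftrightarrow> (AE x in lborel. P x)"
  unfolding vec_normal_def by (subst AE_density) (auto simp: vec_normal_density_pos)

lemma borel_measurable_cis [measurable (raw)]:
  "f \<in> borel_measurable M \<Longrightarrow> (\<lambda>x. cis (f x)) \<in> borel_measurable M"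
  by (rule borel_measurable_continuous_on[where f = cis]) (intro continuous_intros)

lemma
  shows integral_std_normal_cis:
    "(\<integral>t. std_normal_density t *\<^sub>R cis (b * t) \<partial>lborel) = complex_of_real (exp (- b\<^sup>2 / 2))"
  and integrable_std_normal_cis:
    "integrable lborel (\<lambda>t. std_normal_density t *\<^sub>R cis (b * t))"
proof -
  have "(\<integral>t. cis (b * t) \<partial>std_normal_distribution) = complex_of_real (exp (- b\<^sup>2 / 2))"
    using char_std_normal_distribution unfolding char_def by (simp add: fun_eq_iff cis_conv_exp)
  then show "(\<integral>t. std_normal_density t *\<^sub>R cis (b * t) \<partial>lborel) = complex_of_real (exp (- b\<^sup>2 / 2))"
    by (subst (asm) integral_density) auto
  show "integrable lborel (\<lambda>t. std_normal_density t *\<^sub>R cis (b * t))"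
    by (rule Bochner_Integration.integrable_bound[where f = std_normal_density])
      auto
qed

text \<open>Density and character both factor over the coordinates, so the integral is a product of
  one-dimensional characteristic functions.\<close>

lemma
  fixes b :: "'m::finite \<Rightarrow> real"
  shows integral_vec_normal_cis: "(\<integral>x. cis (\<Sum>i\<in>UNIV. b i * x $ i) \<partial>vec_normal) =
      complex_of_real (exp (- (\<Sum>i\<in>UNIV. (b i)\<^sup>2) / 2))"
    and integrable_vec_normal_cis: "integrable vec_normal (\<lambda>x :: real ^ 'm. cis (\<Sum>i\<in>UNIV. b i * x $ i))"
proof -
  have cis_sum: "cis (\<Sum>i\<in>A. h i) = (\<Prod>i\<in>A. cis (h i))" if "finite A" for h and A :: "'m set"
    using that by induction (auto simp flip: cis_mult)
  have eq: "vec_normal_density x *\<^sub>R cis (\<Sum>i\<in>UNIV. b i * x $ i) =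
      (\<Prod>i\<in>UNIV. std_normal_density (x $ i) *\<^sub>R cis (b i * x $ i))" for x
    by (simp add: cis_sum vec_normal_density_def scaleR_conv_of_real prod.distrib)
  show "(\<integral>x. cis (\<Sum>i\<in>UNIV. b i * x $ i) \<partial>vec_normal) =
      complex_of_real (exp (- (\<Sum>i\<in>UNIV. (b i)\<^sup>2) / 2))"
  proof -
    have "(\<integral>x. cis (\<Sum>i\<in>UNIV. b i * x $ i) \<partial>vec_normal) =
        (\<integral>x. (\<Prod>i\<in>UNIV. std_normal_density (x $ i) *\<^sub>R cis (b i * x $ i)) \<partial>(lborel :: (real ^ 'm) measure))"
      unfolding vec_normal_def
      by (subst integral_density) (auto simp: eq vec_normal_density_pos less_imp_le)
    also have "\<dots> = (\<Prod>i\<in>UNIV. complex_of_real (exp (- (b i)\<^sup>2 / 2)))"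
      using integral_lborel_prod_vec[of "\<lambda>i t. std_normal_density t *\<^sub>R cis (b i * t)"]
      by (simp only: integrable_std_normal_cis integral_std_normal_cis)
    also have "\<dots> = complex_of_real (exp (\<Sum>i\<in>UNIV. - (b i)\<^sup>2 / 2))"
      by (simp add: exp_sum)
    also have "(\<Sum>i\<in>UNIV. - (b i)\<^sup>2 / 2) = - (\<Sum>i\<in>UNIV. (b i)\<^sup>2) / 2"
      by (simp add: sum_negf sum_divide_distrib)
    finally show ?thesis .
  qed
  show "integrable vec_normal (\<lambda>x :: real ^ 'm. cis (\<Sum>i\<in>UNIV. b i * x $ i))"
    unfolding vec_normal_def
    using integrable_lborel_prod_vec[of "\<lambda>i t. std_normal_density t *\<^sub>R cis (b i * t)"]
    by (subst integrable_density)
       (simp_all only: eq integrable_std_normal_cis, auto simp: vec_normal_density_pos less_imp_le)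
qed

lemma prob_space_vec_normal: "prob_space (vec_normal :: (real ^ 'm::finite) measure)"
proof
  \<comment> \<open>The total mass is the characteristic function at frequency zero.\<close>
  have i: "integrable (vec_normal :: (real ^ 'm) measure) (\<lambda>_. 1 :: complex)"
    and e: "(\<integral>x. 1 \<partial>(vec_normal :: (real ^ 'm) measure)) = (1 :: complex)"
    using integrable_vec_normal_cis[of "\<lambda>_. 0"] integral_vec_normal_cis[of "\<lambda>_. 0"] by simp_all
  have "emeasure (vec_normal :: (real ^ 'm) measure) UNIV < \<infinity>"
    using i by (simp add: integrable_iff_bounded)
  then show "emeasure (vec_normal :: (real ^ 'm) measure) (space vec_normal) = 1"
    using e by (simp add: emeasure_eq_ennreal_measure less_top scaleR_conv_of_real)
qed

subsection \<open>Fejer kernels along the hyperplane\<close>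

text \<open>The classical Fejer kernel divided by N: for N \<ge> 1 its value at integers is 1 and
  its mean over a period is 1/N.\<close>

definition fejer :: "nat \<Rightarrow> real \<Rightarrow> real" where
  "fejer N t = (cmod (\<Sum>h<N. cis (2 * pi * real h * t)) / real N)\<^sup>2"

lemma fejer_nonneg: "0 \<le> fejer N t"
  by (simp add: fejer_def)

lemma fejer_1: "fejer 1 t = 1"
  by (simp add: fejer_def)

text \<open>The squared modulus is the sum times its conjugate. Pairs are not grouped by their
  difference, so all terms have equal weight and frequency zero is the diagonal.\<close>

lemma fejer_expand:
  "complex_of_real (fejer N t) =
     (\<Sum>p\<in>{..<N}\<times>{..<N}. complex_of_real (1 / (real N)\<^sup>2) * cis (2 * pi * (real (fst p) - real (snd p)) * t))"
proof -
  define S where "S = (\<Sum>h<N. cis (2 * pi * real h * t))"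
  have "complex_of_real (fejer N t) = complex_of_real (1 / (real N)\<^sup>2) * (S * cnj S)"
    using complex_norm_square[of S] by (simp add: fejer_def power_divide flip: S_def)
  also have "S * cnj S = (\<Sum>p\<in>{..<N}\<times>{..<N}. cis (2 * pi * (real (fst p) - real (snd p)) * t))"
    unfolding S_def cnj_sum sum_product sum.cartesian_product
    by (intro sum.cong) (auto simp: cis_cnj cis_mult algebra_simps)
  finally show ?thesis
    by (simp add: sum_distrib_left)
qed

text \<open>The constant 1/8 puts every phase \<open>2 * pi * h * t\<close> with h < N within pi/4
  of a multiple of 2 pi. Each term then has real part at least \<open>sqrt (1/2)\<close>, and no
  cancellation occurs.\<close>

lemma fejer_ge_half:
  assumes "N \<ge> 1" "nint_dist t \<le> 1 / (8 * real N)"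
  shows "fejer N t \<ge> 1 / 2"
proof -
  define s where "s = t - of_int (round t)"
  have s: "\<bar>s\<bar> \<le> 1 / (8 * real N)"
    using assms(2) by (simp add: s_def nint_dist_def)
  have "real N * sqrt (1 / 2) \<le> (\<Sum>h<N. Re (cis (2 * pi * real h * t)))"
  proof -
    have "(\<Sum>h<N. sqrt (1 / 2)) \<le> (\<Sum>h<N. Re (cis (2 * pi * real h * t)))"
    proof (rule sum_mono)
      have sqrt_half: "sqrt (1 / 2) = sqrt 2 / 2"
        by (rule real_sqrt_unique) (auto simp: power_divide)
      fix h assume "h \<in> {..<N}"
      then have "real h * \<bar>s\<bar> \<le> real N * (1 / (8 * real N))"
        using s by (intro mult_mono) auto
      then have hs: "real h * \<bar>s\<bar> \<le> 1 / 8"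
        using assms(1) by simp
      have "cos (2 * pi * real h * t) = cos (2 * pi * (real h * s) + 2 * pi * of_int (int h * round t))"
        by (simp add: s_def algebra_simps)
      also have "\<dots> = cos (2 * pi * (real h * s))"
        by (simp only: cos_add cos_int_2pin sin_int_2pin mult_1_right mult_zero_right diff_0_right)
      also have "\<dots> = cos (2 * pi * (real h * \<bar>s\<bar>))"
        by (cases "s \<ge> 0") auto
      finally have eq: "cos (2 * pi * real h * t) = cos (2 * pi * (real h * \<bar>s\<bar>))" .
      have "cos (pi / 4) \<le> cos (2 * pi * (real h * \<bar>s\<bar>))"
        using hs pi_gt_zero by (intro cos_monotone_0_pi_le) (auto simp: field_simps)
      then show "sqrt (1 / 2) \<le> Re (cis (2 * pi * real h * t))"
        using sqrt_half by (simp only: eq cis.sel cos_45)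
    qed
    then show ?thesis by simp
  qed
  also have "\<dots> \<le> cmod (\<Sum>h<N. cis (2 * pi * real h * t))"
    using complex_Re_le_cmod[of "\<Sum>h<N. cis (2 * pi * real h * t)"] by simp
  finally have "sqrt (1 / 2) \<le> cmod (\<Sum>h<N. cis (2 * pi * real h * t)) / real N"
    using assms(1) by (simp add: field_simps)
  then have "(sqrt (1 / 2))\<^sup>2 \<le> fejer N t"
    unfolding fejer_def by (intro power_mono) auto
  then show ?thesis by simp
qed

text \<open>The normal vector has first entry 1, so the hyperplane is a graph over the remaining
  coordinates.\<close>

definition hyperplane_param :: "real ^ ('m::finite) \<Rightarrow> real \<Rightarrow> real ^ 'm \<Rightarrow> real ^ 'm option" where
  "hyperplane_param \<alpha> c u = (\<chi> i. case i of None \<Rightarrow> c - \<alpha> \<bullet> u | Some j \<Rightarrow> u $ j)"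

lemma sum_UNIV_option:
  "(\<Sum>i\<in>(UNIV :: 'a::finite option set). f i) = f None + (\<Sum>j\<in>UNIV. f (Some j))"
  by (simp add: UNIV_option_conv sum.reindex)

text \<open>A character of frequency d on the whole space restricts to one with frequencies
  \<open>d (Some j) - d None * \<alpha> $ j\<close> in the parameters. These are the linear forms
  that must be bounded below.\<close>

lemma sum_hyperplane_param:
  "(\<Sum>i\<in>UNIV. d i * hyperplane_param \<alpha> c u $ i) = d None * c + (\<Sum>j\<in>UNIV. (d (Some j) - d None * \<alpha> $ j) * u $ j)"
  by (simp add: sum_UNIV_option hyperplane_param_def inner_vec_def algebra_simps sum_subtractf sum_distrib_left)


text \<open>Expanding the kernels gives a sum of characters, each of weight C. Zero frequency occurs
  for \<open>\<Prod>i\<in>UNIV. N i\<close> choices of pairs, which yields the main term; all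
  weights together sum to 1, so the other frequencies add at most E.\<close>

lemma integral_fejer_prod_le:
  fixes \<alpha> :: "real ^ 'm::finite" and N :: "'m option \<Rightarrow> nat" and y :: "real ^ 'm option"
  assumes N: "\<And>i. N i \<ge> 1" and "E \<ge> 0"
    and E: "\<And>d :: 'm option \<Rightarrow> int. (\<And>i. \<bar>d i\<bar> < int (N i)) \<Longrightarrow> d \<noteq> (\<lambda>_. 0 :: int) \<Longrightarrow>
      exp (- (\<Sum>j\<in>UNIV. (2 * pi * n * (d (Some j) - d None * \<alpha> $ j))\<^sup>2) / 2) \<le> E"
  shows "(\<integral>u. (\<Prod>i\<in>UNIV. fejer (N i) (n * hyperplane_param \<alpha> c u $ i - y $ i)) \<partial>vec_normal)
      \<le> (\<Prod>i\<in>UNIV. 1 / real (N i)) + E"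
proof -
  define P where "P = (PiE UNIV (\<lambda>i. {..<N i} \<times> {..<N i}))"
  define D where "D p i = int (fst (p i)) - int (snd (p i))" for p :: "'m option \<Rightarrow> nat \<times> nat" and i
  define C where "C = (\<Prod>i\<in>UNIV. 1 / (real (N i))\<^sup>2)"
  define b where "b p j = 2 * pi * n * (D p (Some j) - D p None * \<alpha> $ j)" for p j
  \<comment> \<open>\<open>K p\<close> collects the part of the phase independent of u, coming from
    c and y; it has modulus-one effect and drops out of the estimate.\<close>
  define K where "K p = 2 * pi * n * D p None * c - (\<Sum>i\<in>UNIV. 2 * pi * D p i * y $ i)" for p
  have finP: "finite P"
    unfolding P_def by (intro finite_PiE) auto
  have cis_sum: "(\<Prod>i\<in>A. cis (h i)) = cis (\<Sum>i\<in>A. h i)" if "finite A" for h and A :: "'m option set"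
    using that by induction (auto simp: cis_mult)
  have phase: "(\<Sum>i\<in>UNIV. 2 * pi * D p i * (n * hyperplane_param \<alpha> c u $ i - y $ i))
      = K p + (\<Sum>j\<in>UNIV. b p j * u $ j)" for p u
    using sum_hyperplane_param[of "\<lambda>i. 2 * pi * n * D p i" \<alpha> c u]
    by (simp add: K_def b_def algebra_simps sum_subtractf)
  have expand: "complex_of_real (\<Prod>i\<in>UNIV. fejer (N i) (n * hyperplane_param \<alpha> c u $ i - y $ i))
      = (\<Sum>p\<in>P. complex_of_real C * cis (K p) * cis (\<Sum>j\<in>UNIV. b p j * u $ j))" for u
  proof -
    have "complex_of_real (\<Prod>i\<in>UNIV. fejer (N i) (n * hyperplane_param \<alpha> c u $ i - y $ i))
        = (\<Sum>p\<in>P. \<Prod>i\<in>UNIV. complex_of_real (1 / (real (N i))\<^sup>2) *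
            cis (2 * pi * D p i * (n * hyperplane_param \<alpha> c u $ i - y $ i)))"
      unfolding of_real_prod fejer_expand P_def D_def
      by (subst prod_sum_PiE) auto
    also have "\<dots> = (\<Sum>p\<in>P. complex_of_real C * cis (K p) * cis (\<Sum>j\<in>UNIV. b p j * u $ j))"
      by (intro sum.cong refl)
         (simp only: prod.distrib cis_sum finite phase C_def of_real_prod, simp add: cis_mult[symmetric])
    finally show ?thesis .
  qed
  define I where "I = (\<integral>u. (\<Prod>i\<in>UNIV. fejer (N i) (n * hyperplane_param \<alpha> c u $ i - y $ i)) \<partial>vec_normal)"
  have "complex_of_real I = (\<integral>u. (\<Sum>p\<in>P. complex_of_real C * cis (K p) * cis (\<Sum>j\<in>UNIV. b p j * u $ j)) \<partial>vec_normal)"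
    unfolding I_def integral_complex_of_real[symmetric] expand ..
  also have "\<dots> = (\<Sum>p\<in>P. complex_of_real C * cis (K p) * complex_of_real (exp (- (\<Sum>j\<in>UNIV. (b p j)\<^sup>2) / 2)))"
    by (subst Bochner_Integration.integral_sum)
       (auto simp: integrable_vec_normal_cis integral_vec_normal_cis)
  finally have "\<bar>I\<bar> = cmod (\<Sum>p\<in>P. complex_of_real C * cis (K p) * complex_of_real (exp (- (\<Sum>j\<in>UNIV. (b p j)\<^sup>2) / 2)))"
    by (metis norm_of_real real_norm_def)
  also have "\<dots> \<le> (\<Sum>p\<in>P. C * exp (- (\<Sum>j\<in>UNIV. (b p j)\<^sup>2) / 2))"
    by (rule sum_norm_le) (simp add: norm_mult C_def prod_nonneg del: of_real_prod)
  also have "\<dots> \<le> (\<Sum>p\<in>P. C * ((if D p = (\<lambda>_. 0) then 1 else 0) + E))"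
  proof (intro sum_mono mult_left_mono)
    fix p assume p: "p \<in> P"
    have "\<bar>D p i\<bar> < int (N i)" for i
    proof -
      have "p i \<in> {..<N i} \<times> {..<N i}"
        using p by (auto simp: P_def PiE_def Pi_def)
      then show ?thesis by (auto simp: D_def)
    qed
    then have "exp (- (\<Sum>j\<in>UNIV. (b p j)\<^sup>2) / 2) \<le> E" if "D p \<noteq> (\<lambda>_. 0)"
      using E[of "D p"] that unfolding b_def by simp
    then show "exp (- (\<Sum>j\<in>UNIV. (b p j)\<^sup>2) / 2) \<le> (if D p = (\<lambda>_. 0) then 1 else 0) + E"
      using \<open>E \<ge> 0\<close> by (auto simp: sum_nonneg intro: add_increasing2)
  qed (auto simp: C_def prod_nonneg)
  also have "\<dots> = C * real (card {p \<in> P. D p = (\<lambda>_. 0)}) + C * real (card P) * E"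
    using finP by (simp add: distrib_left sum.distrib sum.If_cases Int_def flip: sum_distrib_left)
  \<comment> \<open>All differences vanish exactly when every pair lies on the diagonal.\<close>
  also have "{p \<in> P. D p = (\<lambda>_. 0)} = PiE UNIV (\<lambda>i. (\<lambda>h. (h, h)) ` {..<N i})"
    by (auto simp: P_def D_def PiE_def Pi_def fun_eq_iff image_iff mem_Times_iff prod_eq_iff)
  also have "card \<dots> = (\<Prod>i\<in>UNIV. N i)"
    by (subst card_PiE) (auto simp: card_image inj_on_def)
  also have "card P = (\<Prod>i\<in>UNIV. (N i)\<^sup>2)"
    unfolding P_def by (subst card_PiE) (auto simp: power2_eq_square)
  also have "C * real (\<Prod>i\<in>UNIV. N i) = (\<Prod>i\<in>UNIV. 1 / real (N i))"
    using N by (auto simp: C_def power2_eq_square Suc_le_eq simp flip: prod.distrib intro!: prod.cong)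
  also have "C * real (\<Prod>i\<in>UNIV. (N i)\<^sup>2) = 1"
    using N by (auto simp: C_def Suc_le_eq simp flip: prod.distrib intro!: prod.neutral)
  finally show ?thesis
    unfolding I_def by linarith
qed

subsection \<open>Covering by dyadic boxes\<close>

text \<open>
  The case \<open>m i = 0\<close> imposes no constraint: distances to the nearest integer may exceed 1/8, and a
  Fejer kernel of order 1 majorises the constant 1.
\<close>

definition dyadic_box :: "('a \<Rightarrow> nat) \<Rightarrow> ('a \<Rightarrow> real) set" where
  "dyadic_box m = {t. \<forall>i. m i = 0 \<or> t i \<le> 1 / (8 * 2 ^ m i)}"

lemma dyadic_box_antimono:
  assumes "t \<in> dyadic_box m" "\<And>i. m' i \<le> m i"
  shows "t \<in> dyadic_box m'"
  unfolding dyadic_box_def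
proof (intro CollectI allI)
  fix i
  show "m' i = 0 \<or> t i \<le> 1 / (8 * 2 ^ m' i)"
  proof (cases "m' i = 0")
    case False
    then have "m i \<noteq> 0"
      using assms(2)[of i] by simp
    moreover have "m i = 0 \<or> t i \<le> 1 / (8 * 2 ^ m i)"
      using assms(1) by (simp add: dyadic_box_def)
    ultimately have "t i \<le> 1 / (8 * 2 ^ m i)"
      by simp
    also have "\<dots> \<le> 1 / (8 * 2 ^ m' i)"
      using assms(2)[of i] by (intro divide_left_mono mult_left_mono power_increasing) auto
    finally show ?thesis ..
  qed simp
qed

text \<open>Lower a positive entry by one until the sum is right. Fixing the total exponent keeps
  the number of boxes small.\<close>

lemma ex_le_fun_sum_eq:
  fixes m :: "'a::finite \<Rightarrow> nat"
  assumes "L \<le> sum m UNIV"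
  shows "\<exists>m'. (\<forall>i. m' i \<le> m i) \<and> sum m' UNIV = L"
  using assms
proof (induction "sum m UNIV - L" arbitrary: m)
  case 0
  then show ?case by (intro exI[of _ m]) auto
next
  case (Suc n)
  then have "sum m UNIV \<noteq> 0" by linarith
  then obtain i where i: "m i \<noteq> 0" by (meson sum.neutral)
  define m1 where "m1 = m(i := m i - 1)"
  have "sum m UNIV = m i + sum m (UNIV - {i})"
    by (simp add: sum.remove)
  moreover have "sum m1 UNIV = m1 i + sum m1 (UNIV - {i})"
    by (simp add: sum.remove)
  moreover have "sum m1 (UNIV - {i}) = sum m (UNIV - {i})"
    by (intro sum.cong) (auto simp: m1_def)
  ultimately have s: "sum m UNIV = Suc (sum m1 UNIV)"
    using i by (simp add: m1_def)
  have "n = sum m1 UNIV - L" "L \<le> sum m1 UNIV"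
    using Suc(2) s by linarith+
  then obtain m' where "\<forall>j. m' j \<le> m1 j" "sum m' UNIV = L"
    using Suc(1)[of m1] by blast
  moreover have "m1 j \<le> m j" for j by (simp add: m1_def)
  ultimately show ?case
    by (intro exI[of _ m']) (auto intro: order_trans)
qed

text \<open>Take each exponent as large as possible, up to L. If one reaches L, the total suffices;
  otherwise maximality bounds every \<open>t i\<close> from below, and a small total would
  contradict the small product. The total is then lowered to the prescribed value.\<close>

lemma prod_less_imp_mem_dyadic_box:
  fixes t :: "'a::finite \<Rightarrow> real"
  assumes t: "\<And>i. 0 \<le> t i" and less: "(\<Prod>i\<in>UNIV. t i) < (1/2) ^ L"
  shows "\<exists>m. sum m UNIV = L - 4 * CARD('a) \<and> t \<in> dyadic_box m"
proof -
  \<comment> \<open>The cap L keeps the set finite even when \<open>t i = 0\<close>; it contains 0,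
    so the maximum exists.\<close>
  define S where "S i = {m. m \<le> L \<and> (m = 0 \<or> t i \<le> 1 / (8 * 2 ^ m))}" for i
  define m where "m i = Max (S i)" for i
  have fin: "finite (S i)" and ne: "S i \<noteq> {}" for i
    by (auto simp: S_def intro: finite_subset[of _ "{..L}"])
  have mS: "m i \<in> S i" for i
    unfolding m_def by (rule Max_in[OF fin ne])
  have box: "t \<in> dyadic_box m"
    using mS by (auto simp: dyadic_box_def S_def)
  have "L - 4 * CARD('a) \<le> sum m UNIV"
  proof (cases "\<exists>i. m i = L")
    case True
    then obtain i where "m i = L" ..
    moreover have "m i \<le> sum m UNIV"
      by (rule member_le_sum) auto
    ultimately show ?thesis by simp
  next
    case False
    \<comment> \<open>The 4 is 3 for the factor 8 plus 1 for the failing exponent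
      \<open>Suc (m i)\<close>.\<close>
    have "(1/2) ^ (m i + 4) < t i" for i
    proof -
      have "m i < L"
        using mS[of i] False by (auto simp: S_def order_le_less)
      have "Suc (m i) \<notin> S i"
        using Max_ge[OF fin, of "Suc (m i)" i] by (auto simp: m_def)
      then have "1 / (8 * 2 ^ Suc (m i)) < t i"
        using \<open>m i < L\<close> by (simp add: S_def)
      then show ?thesis by (simp add: power_add power_divide)
    qed
    then have "(\<Prod>i\<in>UNIV. (1/2) ^ (m i + 4)) \<le> (\<Prod>i\<in>UNIV. t i)"
      by (intro prod_mono) (auto simp: less_imp_le)
    also have "(\<Prod>i\<in>UNIV. (1/2 :: real) ^ (m i + 4)) = (1/2) ^ (sum m UNIV + 4 * CARD('a))"
      by (simp add: sum.distrib mult.commute flip: power_sum)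
    finally have "(1/2) ^ (sum m UNIV + 4 * CARD('a)) < (1/2 :: real) ^ L"
      using less by (rule le_less_trans)
    then have "L < sum m UNIV + 4 * CARD('a)"
      by (subst (asm) power_strict_decreasing_iff) simp_all
    then show ?thesis by simp
  qed
  then obtain m' where "\<forall>i. m' i \<le> m i" "sum m' UNIV = L - 4 * CARD('a)"
    using ex_le_fun_sum_eq by blast
  then show ?thesis
    using dyadic_box_antimono[OF box] by blast
qed

text \<open>With the sum fixed, the entry at \<open>None\<close> is determined by the others. This
  saves one factor and gives the power k - 1 of the logarithm.\<close>

lemma
  shows finite_fun_sum_eq: "finite {m :: 'm::finite option \<Rightarrow> nat. sum m UNIV = L}" (is "finite ?A")
    and card_fun_sum_eq_le: "card {m :: 'm::finite option \<Rightarrow> nat. sum m UNIV = L} \<le> Suc L ^ CARD('m)"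
proof -
  let ?r = "\<lambda>m :: 'm option \<Rightarrow> nat. \<lambda>j. m (Some j)"
  let ?B = "PiE (UNIV :: 'm set) (\<lambda>_. {..L})"
  have inj: "inj_on ?r ?A"
  proof (rule inj_onI)
    fix m m' :: "'m option \<Rightarrow> nat"
    assume A: "m \<in> ?A" "m' \<in> ?A" and eq: "?r m = ?r m'"
    have S: "m (Some j) = m' (Some j)" for j
      using eq by meson
    then have "m None = m' None"
      using A by (simp add: sum_UNIV_option)
    show "m = m'"
    proof
      fix i show "m i = m' i"
        using S \<open>m None = m' None\<close> by (cases i) auto
    qed
  qed
  have "m i \<le> L" if "m \<in> ?A" for m i
    using that member_le_sum[of i UNIV m] by simp
  then have sub: "?r ` ?A \<subseteq> ?B"
    by auto
  have fin: "finite ?B"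
    by (intro finite_PiE) auto
  show "finite ?A"
    using finite_imageD[OF finite_subset[OF sub fin] inj] .
  have "card ?A \<le> card ?B"
    by (rule card_inj_on_le[OF inj sub fin])
  then show "card ?A \<le> Suc L ^ CARD('m)"
    by (simp add: card_PiE)
qed

subsection \<open>Diophantine lower bound\<close>

lemma nint_dist_le: "nint_dist x \<le> \<bar>x - of_int k\<bar>"
  unfolding nint_dist_def using round_diff_minimal[of x k] by simp

lemma nint_dist_minus: "nint_dist (- x) = nint_dist x"
proof -
  have "nint_dist (- x) \<le> nint_dist x" for x
    using nint_dist_le[of "- x" "- round x"] by (simp add: nint_dist_def)
  from this[of x] this[of "- x"] show ?thesis by simp
qed

lemma nint_dist_nonneg: "0 \<le> nint_dist x"
  by (simp add: nint_dist_def)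

text \<open>The exponent gives the bound for all large q, and c absorbs the finitely many others
  once their distances are known to be positive.\<close>

lemma simult_exponent_lower_bound:
  fixes \<alpha> :: "real ^ 'm::finite"
  assumes "simult_exponent \<alpha> < ereal w" "0 < w"
  shows "\<exists>c>0. \<forall>q\<ge>1. c * real q powr - w \<le> (MAX i. nint_dist (real q * \<alpha> $ i))"
proof -
  define M where "M q = (MAX i. nint_dist (real q * \<alpha> $ i))" for q :: nat
  have not_inf: "\<not> (\<exists>\<^sub>\<infinity>q. q \<ge> 1 \<and> M q < real q powr - w)"
  proof
    assume "\<exists>\<^sub>\<infinity>q. q \<ge> 1 \<and> M q < real q powr - w"
    then have "ereal w \<le> simult_exponent \<alpha>"
      unfolding simult_exponent_def M_def by (intro Sup_upper) auto
    with assms(1) show False by simp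
  qed
  then obtain q0 where q0: "\<And>q. q \<ge> q0 \<Longrightarrow> q \<ge> 1 \<Longrightarrow> real q powr - w \<le> M q"
    unfolding INFM_nat_le by (meson not_less)
  \<comment> \<open>If \<open>M q\<close> were 0, it would be 0 at all multiples of q, against the
    bound at a multiple beyond \<open>q0\<close>.\<close>
  have M0: "M q > 0" if "q \<ge> 1" for q
  proof (rule ccontr)
    assume "\<not> M q > 0"
    then have z: "nint_dist (real q * \<alpha> $ i) = 0" for i
    proof -
      have "nint_dist (real q * \<alpha> $ i) \<le> M q"
        unfolding M_def by (rule Max_ge) auto
      with \<open>\<not> M q > 0\<close> nint_dist_nonneg[of "real q * \<alpha> $ i"] show ?thesis
        by linarith
    qed
    have multiple: "M (q * k) = 0" for k
    proof -
      have "nint_dist (real (q * k) * \<alpha> $ i) = 0" for i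
      proof -
        have "real q * \<alpha> $ i = of_int (round (real q * \<alpha> $ i))"
          using z[of i] by (simp add: nint_dist_def)
        then have "real (q * k) * \<alpha> $ i = of_int (int k * round (real q * \<alpha> $ i))"
          by (metis mult.commute mult.left_commute of_int_mult of_int_of_nat_eq of_nat_mult)
        then show ?thesis
          using nint_dist_le[of "real (q * k) * \<alpha> $ i" "int k * round (real q * \<alpha> $ i)"]
            nint_dist_nonneg[of "real (q * k) * \<alpha> $ i"] by linarith
      qed
      then show ?thesis by (simp add: M_def)
    qed
    have "real (q * Suc q0) powr - w \<le> M (q * Suc q0)"
    proof (rule q0)
      have "Suc q0 \<le> q * Suc q0"
        using that by (cases q) simp_all
      then show "q0 \<le> q * Suc q0"
        by (rule Suc_leD)
      from \<open>Suc q0 \<le> q * Suc q0\<close> show "1 \<le> q * Suc q0"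
        by (rule order_trans[rotated]) simp
    qed
    moreover have "0 < real (q * Suc q0) powr - w"
      using that by (simp del: mult_Suc_right)
    ultimately show False
      using multiple[of "Suc q0"] by linarith
  qed
  define c where "c = Min (insert 1 (M ` {1..q0}))"
  show ?thesis
  proof (intro exI[of _ c] conjI allI impI)
    show "c > 0"
      unfolding c_def using M0 by (subst Min_gr_iff) auto
    fix q :: nat assume q: "q \<ge> 1"
    show "c * real q powr - w \<le> (MAX i. nint_dist (real q * \<alpha> $ i))"
      unfolding M_def[symmetric]
    proof (cases "q \<ge> q0")
      case True
      have "c \<le> 1" unfolding c_def by (rule Min_le) auto
      then have "c * real q powr - w \<le> 1 * real q powr - w"
        by (intro mult_right_mono) auto
      also have "\<dots> \<le> M q" using q0 True q by simp
      finally show "c * real q powr - w \<le> M q" .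
    next
      case False
      have "c * real q powr - w \<le> c * 1"
        using \<open>c > 0\<close> q assms(2) by (intro mult_left_mono) (auto simp: powr_le_one_le powr_minus_divide ge_one_powr_ge_zero)
      also have "\<dots> \<le> M q"
        unfolding c_def mult_1_right using q False by (intro Min_le) auto
      finally show "c * real q powr - w \<le> M q" .
    qed
  qed
qed

text \<open>If \<open>d None = 0\<close>, some form is a nonzero integer. Otherwise let D be the
  least \<open>N i\<close> over the l relevant indices, so \<open>D ^ l \<le> X\<close>. For
  \<open>\<bar>d None\<bar> \<le> D / c0\<close> the exponent bound applies; for larger
  \<open>d None\<close> some \<open>d None * \<alpha> $ j\<close> dominates
  \<open>d (Some j)\<close>.\<close>

lemma linear_forms_lower_bound:
  fixes \<alpha> :: "real ^ 'm::finite"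
  assumes w: "simult_exponent \<alpha> < ereal w" "0 < w"
    and l: "l = 1 + card {i. \<alpha> $ i \<noteq> 0}"
  shows "\<exists>\<kappa>>0. \<forall>(N :: 'm option \<Rightarrow> nat) (d :: 'm option \<Rightarrow> int) X.
    (\<forall>i. N i \<ge> 1) \<longrightarrow> real (\<Prod>i\<in>UNIV. N i) \<le> X \<longrightarrow> (\<forall>i. \<bar>d i\<bar> < int (N i)) \<longrightarrow> d \<noteq> (\<lambda>_. 0 :: int) \<longrightarrow>
      (\<kappa> * X powr (- w / l))\<^sup>2 \<le> (\<Sum>j\<in>UNIV. (d (Some j) - d None * \<alpha> $ j)\<^sup>2)"
proof -
  obtain c where c: "c > 0" "\<And>q. q \<ge> 1 \<Longrightarrow> c * real q powr - w \<le> (MAX i. nint_dist (real q * \<alpha> $ i))"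
    using simult_exponent_lower_bound[OF w] by blast
  define J where "J = {i. \<alpha> $ i \<noteq> 0}"
  \<comment> \<open>Half the least nonzero \<open>\<bar>\<alpha> $ i\<bar>\<close>. Inserting 2
    makes the minimum exist for empty J and gives \<open>c0 \<le> 1\<close>.\<close>
  define c0 where "c0 = Min (insert 2 ((\<lambda>i. \<bar>\<alpha> $ i\<bar>) ` J)) / 2"
  have c0: "0 < c0" "c0 \<le> 1" "\<And>i. i \<in> J \<Longrightarrow> c0 \<le> \<bar>\<alpha> $ i\<bar> / 2"
  proof -
    show "0 < c0"
      unfolding c0_def by (simp add: J_def)
    show "c0 \<le> 1"
      using Min_le[of "insert 2 ((\<lambda>i. \<bar>\<alpha> $ i\<bar>) ` J)" 2] by (simp add: c0_def)
    show "c0 \<le> \<bar>\<alpha> $ i\<bar> / 2" if "i \<in> J" for i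
      using Min_le[of "insert 2 ((\<lambda>i. \<bar>\<alpha> $ i\<bar>) ` J)" "\<bar>\<alpha> $ i\<bar>"] that by (simp add: c0_def)
  qed
  \<comment> \<open>The first entry serves the cases where a form is bounded away from 0, the second
    comes from inserting \<open>q \<le> D / c0\<close> into \<open>c * q powr - w\<close>.\<close>
  define \<kappa> where "\<kappa> = min c0 (c * c0 powr w)"
  have "\<kappa> > 0" using c0 c by (simp add: \<kappa>_def)
  show ?thesis
  proof (intro exI[of _ \<kappa>] conjI allI impI)
    show "\<kappa> > 0" by fact
    fix N :: "'m option \<Rightarrow> nat" and d :: "'m option \<Rightarrow> int" and X :: real
    assume N: "\<forall>i. N i \<ge> 1" and X: "real (\<Prod>i\<in>UNIV. N i) \<le> X"
      and d: "\<forall>i. \<bar>d i\<bar> < int (N i)" "d \<noteq> (\<lambda>_. 0 :: int)"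
    have "1 \<le> (\<Prod>i\<in>UNIV. N i)"
      using N by (simp add: Suc_le_eq prod_pos)
    then have X1: "X \<ge> 1" using X by linarith
    have Xw: "X powr (- w / l) \<le> 1"
      using X1 w by (simp add: powr_minus_divide ge_one_powr_ge_zero)
    have suff: "(\<kappa> * X powr (- w / l))\<^sup>2 \<le> (\<Sum>j\<in>UNIV. (d (Some j) - d None * \<alpha> $ j)\<^sup>2)" if "a \<le> \<bar>d (Some j) - d None * \<alpha> $ j\<bar>" "\<kappa> * X powr (- w / l) \<le> a" for a j
    proof -
      have "\<kappa> * X powr (- w / l) \<le> \<bar>d (Some j) - d None * \<alpha> $ j\<bar>"
        using that by linarith
      then have "(\<kappa> * X powr (- w / l))\<^sup>2 \<le> (d (Some j) - d None * \<alpha> $ j)\<^sup>2"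
        using \<open>\<kappa> > 0\<close> by (intro abs_le_square_iff[THEN iffD1]) auto
      also have "\<dots> \<le> (\<Sum>j\<in>UNIV. (d (Some j) - d None * \<alpha> $ j)\<^sup>2)"
        by (rule member_le_sum) auto
      finally show ?thesis .
    qed
    have \<kappa>X: "\<kappa> * X powr (- w / l) \<le> c0"
    proof -
      have "\<kappa> * X powr (- w / l) \<le> \<kappa> * 1"
        using \<open>\<kappa> > 0\<close> Xw by (intro mult_left_mono) auto
      also have "\<dots> \<le> c0" by (simp add: \<kappa>_def)
      finally show ?thesis .
    qed
    show "(\<kappa> * X powr (- w / l))\<^sup>2 \<le> (\<Sum>j\<in>UNIV. (d (Some j) - d None * \<alpha> $ j)\<^sup>2)"
    proof (cases "d None = 0")
      case True
      obtain i where i: "d i \<noteq> 0" using d(2) by auto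
      with True obtain j where "i = Some j" by (cases i) auto
      then have "1 \<le> \<bar>d (Some j) - d None * \<alpha> $ j\<bar>"
        using True i by simp
      moreover have "\<kappa> * X powr (- w / l) \<le> 1"
        using \<kappa>X c0(2) by linarith
      ultimately show ?thesis by (rule suff)
    next
      case False
      define A where "A = insert None (Some ` J)"
      have A: "finite A" "A \<noteq> {}" "card A = l"
        by (auto simp: A_def l J_def card_insert_if card_image)
      obtain i0 where i0: "i0 \<in> A" "\<And>i. i \<in> A \<Longrightarrow> N i0 \<le> N i"
        using arg_min_if_finite(1)[OF A(1,2), of N] arg_min_least[OF A(1,2), of _ N] by blast
      define D where "D = N i0"
      have "D \<ge> 1" using N by (simp add: D_def)
      have "D ^ l = (\<Prod>i\<in>A. D)" by (simp add: A)
      also have "\<dots> \<le> (\<Prod>i\<in>A. N i)"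
        using i0 by (intro prod_mono) (auto simp: D_def)
      also have "\<dots> \<le> (\<Prod>i\<in>UNIV. N i)"
        using N by (intro dvd_imp_le prod_dvd_prod_subset) (auto simp: prod_pos Suc_le_eq)
      finally have "real D ^ l \<le> X"
        using X by (metis of_nat_mono of_nat_power order_trans)
      then have "(real D ^ l) powr (- w / l) \<ge> X powr (- w / l)"
        using \<open>D \<ge> 1\<close> w by (intro powr_mono2') auto
      also have "(real D ^ l) powr (- w / l) = real D powr - w"
      proof -
        have "l > 0" by (simp add: l)
        have "real D ^ l = real D powr real l"
          using \<open>D \<ge> 1\<close> by (simp add: powr_realpow)
        then show ?thesis
          using \<open>l > 0\<close> by (simp only: powr_powr) simp
      qed
      finally have DX: "X powr (- w / l) \<le> real D powr - w" .
      define q where "q = nat \<bar>d None\<bar>"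
      have q: "q \<ge> 1" "real q = \<bar>of_int (d None)\<bar>"
        using False by (auto simp: q_def)
      show ?thesis
      proof (cases "real q \<le> real D / c0")
        case True
        have "(MAX i. nint_dist (real q * \<alpha> $ i)) \<in> range (\<lambda>i. nint_dist (real q * \<alpha> $ i))"
          by (rule Max_in) auto
        then obtain j where j: "(MAX i. nint_dist (real q * \<alpha> $ i)) = nint_dist (real q * \<alpha> $ j)"
          by (elim rangeE) (rule that)
        have "nint_dist (real q * \<alpha> $ j) = nint_dist (d None * \<alpha> $ j)"
          using nint_dist_minus[of "d None * \<alpha> $ j"] by (simp add: q(2) abs_if)
        also have "\<dots> \<le> \<bar>d None * \<alpha> $ j - d (Some j)\<bar>"
          by (rule nint_dist_le)
        finally have "c * real q powr - w \<le> \<bar>d (Some j) - d None * \<alpha> $ j\<bar>"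
          using c(2)[OF q(1)] j by (simp add: abs_minus_commute)
        moreover have "\<kappa> * X powr (- w / l) \<le> c * real q powr - w"
        proof -
          have "\<kappa> * X powr (- w / l) \<le> (c * c0 powr w) * real D powr - w"
            using DX c c0 by (intro mult_mono) (auto simp: \<kappa>_def)
          also have "\<dots> = c * (real D / c0) powr - w"
            using c0 by (simp add: powr_divide powr_minus divide_simps)
          also have "\<dots> \<le> c * real q powr - w"
            using True c q w by (intro mult_left_mono powr_mono2') auto
          finally show ?thesis .
        qed
        ultimately show ?thesis by (rule suff)
      next
        case False
        \<comment> \<open>Here q exceeds D while \<open>q < N None\<close>, so the minimum D is
          attained at some \<open>Some j\<close> with j in J. There
          \<open>\<bar>d (Some j)\<bar> < D < c0 * q\<close>, at most half of
          \<open>\<bar>d None * \<alpha> $ j\<bar>\<close>.\<close>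
        then have Dq: "real D < c0 * real q"
          using c0 by (simp add: field_simps)
        also have "c0 * real q \<le> 1 * real q"
          using c0 by (intro mult_right_mono) auto
        finally have "D < q" by simp
        moreover have "int q < N None"
          using d(1) by (simp add: q_def)
        ultimately have "i0 \<noteq> None" by (intro notI) (simp add: D_def)
        then obtain j where j: "j \<in> J" "i0 = Some j"
          using i0(1) by (auto simp: A_def)
        have "\<bar>d (Some j)\<bar> < int D"
          using d(1) by (simp add: D_def j)
        then have "\<bar>real_of_int (d (Some j))\<bar> < real D"
          by linarith
        then have "\<bar>real_of_int (d (Some j))\<bar> \<le> c0 * real q"
          using Dq by linarith
        moreover have "2 * c0 * real q \<le> \<bar>d None * \<alpha> $ j\<bar>"
          using mult_right_mono[of "2 * c0" "\<bar>\<alpha> $ j\<bar>" "real q"] c0(3)[OF j(1)] q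
          by (simp add: abs_mult mult.commute)
        moreover have "c0 * 1 \<le> c0 * real q"
          using q c0 by (intro mult_left_mono) auto
        ultimately have "c0 \<le> \<bar>d (Some j) - d None * \<alpha> $ j\<bar>"
          by linarith
        then show ?thesis using \<kappa>X by (rule suff)
      qed
    qed
  qed
qed

subsection \<open>Measure of the approximation sets\<close>

lemma borel_measurable_nint_dist [measurable]: "nint_dist \<in> borel_measurable borel"
  unfolding nint_dist_eq_infdist[abs_def]
  by (intro borel_measurable_continuous_onI continuous_intros)

lemma borel_measurable_fejer [measurable]: "fejer N \<in> borel_measurable borel"
  unfolding fejer_def[abs_def] by measurable

lemma borel_measurable_hyperplane_param [measurable]:
  "(\<lambda>u. hyperplane_param \<alpha> c u $ i) \<in> borel_measurable borel"
  by (cases i) (auto simp: hyperplane_param_def)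

lemma fejer_le_1: "fejer N t \<le> 1"
proof -
  have "cmod (\<Sum>h<N. cis (2 * pi * real h * t)) \<le> (\<Sum>h<N. 1)"
    by (intro sum_norm_le) auto
  then have "cmod (\<Sum>h<N. cis (2 * pi * real h * t)) / real N \<le> 1"
    by (cases "N = 0") (auto simp: field_simps)
  then show ?thesis
    unfolding fejer_def by (intro power_le_one) auto
qed

text \<open>On the box every kernel is at least 1/2, so \<open>2 ^ CARD('m option)\<close> times
  their product majorises the indicator.\<close>

lemma measure_dyadic_box_le:
  fixes \<alpha> :: "real ^ 'm::finite" and m :: "'m option \<Rightarrow> nat" and y :: "real ^ 'm option"
  assumes "E \<ge> 0"
    and E: "\<And>d :: 'm option \<Rightarrow> int. (\<And>i. \<bar>d i\<bar> < (2 :: int) ^ m i) \<Longrightarrow> d \<noteq> (\<lambda>_. 0 :: int) \<Longrightarrow>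
      exp (- (\<Sum>j\<in>UNIV. (2 * pi * n * (d (Some j) - d None * \<alpha> $ j))\<^sup>2) / 2) \<le> E"
  shows "measure vec_normal {u. (\<lambda>i. nint_dist (n * hyperplane_param \<alpha> c u $ i - y $ i)) \<in> dyadic_box m}
      \<le> 2 ^ CARD('m option) * ((1/2) ^ sum m UNIV + E)"
proof -
  interpret prob_space "vec_normal :: (real ^ 'm) measure"
    by (rule prob_space_vec_normal)
  define B where "B = {u. (\<lambda>i. nint_dist (n * hyperplane_param \<alpha> c u $ i - y $ i)) \<in> dyadic_box m}"
  define F where "F u = (\<Prod>i\<in>UNIV. fejer (2 ^ m i) (n * hyperplane_param \<alpha> c u $ i - y $ i))" for u
  have [measurable]: "B \<in> sets borel"
    unfolding B_def dyadic_box_def mem_Collect_eq by measurable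
  have F_nonneg: "0 \<le> F u" for u
    unfolding F_def by (intro prod_nonneg) (simp add: fejer_nonneg)
  have [measurable]: "F \<in> borel_measurable borel"
    unfolding F_def[abs_def] by measurable
  have "integrable vec_normal F"
  proof (rule integrable_const_bound[where B = 1])
    show "AE u in vec_normal. norm (F u) \<le> 1"
      using F_nonneg by (auto simp: F_def fejer_nonneg fejer_le_1 intro!: prod_le_1)
  qed simp
  have "indicator B u \<le> 2 ^ CARD('m option) * F u" for u
  proof (cases "u \<in> B")
    case True
    have "(\<Prod>i\<in>(UNIV :: 'm option set). 1/2) \<le> F u"
      unfolding F_def
    proof (intro prod_mono conjI)
      fix i
      show "1/2 \<le> fejer (2 ^ m i) (n * hyperplane_param \<alpha> c u $ i - y $ i)"
      proof (cases "m i = 0")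
        case True
        then show ?thesis using fejer_1 by simp
      next
        case False
        moreover have "m i = 0 \<or> nint_dist (n * hyperplane_param \<alpha> c u $ i - y $ i) \<le> 1 / (8 * real (2 ^ m i))"
          using \<open>u \<in> B\<close> unfolding B_def dyadic_box_def by simp
        ultimately have "nint_dist (n * hyperplane_param \<alpha> c u $ i - y $ i) \<le> 1 / (8 * real (2 ^ m i))"
          by simp
        then show ?thesis
          by (intro fejer_ge_half) simp_all
      qed
    qed simp
    then show ?thesis
      using True by (simp add: field_simps)
  next
    case False
    then show ?thesis using F_nonneg by simp
  qed
  then have "(\<integral>u. indicator B u \<partial>vec_normal) \<le> (\<integral>u. 2 ^ CARD('m option) * F u \<partial>vec_normal)"
    using \<open>integrable vec_normal F\<close>
    by (intro integral_mono) (auto simp: integrable_real_indicator emeasure_eq_measure)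
  then have "measure vec_normal B \<le> 2 ^ CARD('m option) * (\<integral>u. F u \<partial>vec_normal)"
    by simp
  also have "(\<integral>u. F u \<partial>vec_normal) \<le> (\<Prod>i\<in>UNIV. 1 / real (2 ^ m i)) + E"
    unfolding F_def
  proof (rule integral_fejer_prod_le)
    fix d :: "'m option \<Rightarrow> int"
    assume "\<And>i. \<bar>d i\<bar> < int (2 ^ m i)" "d \<noteq> (\<lambda>_. 0 :: int)"
    then show "exp (- (\<Sum>j\<in>UNIV. (2 * pi * n * (d (Some j) - d None * \<alpha> $ j))\<^sup>2) / 2) \<le> E"
      using E[of d] by simp
  qed (use \<open>E \<ge> 0\<close> in auto)
  also have "(\<Prod>i\<in>UNIV. 1 / real (2 ^ m i)) = (1/2) ^ sum m UNIV"
    by (simp add: power_sum power_divide)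
  finally show ?thesis
    by (simp add: B_def)
qed

definition approx_set :: "real ^ ('m::finite) \<Rightarrow> real \<Rightarrow> real ^ 'm option \<Rightarrow> nat \<Rightarrow> real \<Rightarrow> (real ^ 'm) set" where
  "approx_set \<alpha> c y n \<delta> =
     {u. (\<Prod>i\<in>UNIV. nint_dist (real n * hyperplane_param \<alpha> c u $ i - y $ i)) < \<delta>}"

lemma sets_approx_set [measurable]: "approx_set \<alpha> c y n \<delta> \<in> sets borel"
  unfolding approx_set_def by measurable

text \<open>A union bound over the covering boxes, all of total exponent \<open>L'\<close>; the
  factor \<open>2 ^ (4 * CARD('m option))\<close> pays for passing from L to
  \<open>L'\<close>.\<close>

lemma measure_approx_set_le:
  fixes \<alpha> :: "real ^ 'm::finite" and y :: "real ^ 'm option"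
  assumes "\<delta> \<le> (1/2) ^ L" "E \<ge> 0"
    and E: "\<And>(m :: 'm option \<Rightarrow> nat) (d :: 'm option \<Rightarrow> int).
      sum m UNIV \<le> L \<Longrightarrow> (\<And>i. \<bar>d i\<bar> < (2 :: int) ^ m i) \<Longrightarrow> d \<noteq> (\<lambda>_. 0 :: int) \<Longrightarrow>
      exp (- (\<Sum>j\<in>UNIV. (2 * pi * real n * (d (Some j) - d None * \<alpha> $ j))\<^sup>2) / 2) \<le> E"
  shows "measure vec_normal (approx_set \<alpha> c y n \<delta>)
      \<le> real (Suc L) ^ CARD('m) * (2 ^ CARD('m option) * (2 ^ (4 * CARD('m option)) * (1/2) ^ L + E))"
proof -
  interpret prob_space "vec_normal :: (real ^ 'm) measure"
    by (rule prob_space_vec_normal)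
  define L' where "L' = L - 4 * CARD('m option)"
  define A where "A = {m :: 'm option \<Rightarrow> nat. sum m UNIV = L'}"
  define B where "B m = {u. (\<lambda>i. nint_dist (real n * hyperplane_param \<alpha> c u $ i - y $ i)) \<in> dyadic_box m}" for m
  have [measurable]: "B m \<in> sets borel" for m
    unfolding B_def dyadic_box_def mem_Collect_eq by measurable
  have "finite A"
    unfolding A_def by (rule finite_fun_sum_eq)
  have "approx_set \<alpha> c y n \<delta> \<subseteq> (\<Union>m\<in>A. B m)"
  proof
    fix u assume "u \<in> approx_set \<alpha> c y n \<delta>"
    then have "(\<Prod>i\<in>UNIV. nint_dist (real n * hyperplane_param \<alpha> c u $ i - y $ i)) < (1/2) ^ L"
      using assms(1) unfolding approx_set_def by simp
    then show "u \<in> (\<Union>m\<in>A. B m)"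
      using prod_less_imp_mem_dyadic_box[of "\<lambda>i. nint_dist (real n * hyperplane_param \<alpha> c u $ i - y $ i)" L]
      by (auto simp: nint_dist_nonneg A_def B_def L'_def)
  qed
  then have "measure vec_normal (approx_set \<alpha> c y n \<delta>) \<le> measure vec_normal (\<Union>m\<in>A. B m)"
    using \<open>finite A\<close> by (intro finite_measure_mono) (auto intro!: sets.finite_UN)
  also have "\<dots> \<le> (\<Sum>m\<in>A. measure vec_normal (B m))"
    using \<open>finite A\<close> by (intro finite_measure_subadditive_finite) auto
  also have "\<dots> \<le> (\<Sum>m\<in>A. 2 ^ CARD('m option) * ((1/2) ^ L' + E))"
  proof (rule sum_mono)
    fix m assume "m \<in> A"
    then have "sum m UNIV = L'" by (simp add: A_def)
    then show "measure vec_normal (B m) \<le> 2 ^ CARD('m option) * ((1/2) ^ L' + E)"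
      using measure_dyadic_box_le[of E m "real n" \<alpha> c y] E[of m] \<open>E \<ge> 0\<close>
      unfolding B_def by (simp add: L'_def)
  qed
  also have "\<dots> = real (card A) * (2 ^ CARD('m option) * ((1/2) ^ L' + E))"
    by simp
  also have "\<dots> \<le> real (Suc L) ^ CARD('m) * (2 ^ CARD('m option) * (2 ^ (4 * CARD('m option)) * (1/2) ^ L + E))"
  proof (intro mult_mono add_mono order_refl)
    have "card A \<le> Suc L' ^ CARD('m)"
      unfolding A_def by (rule card_fun_sum_eq_le)
    also have "\<dots> \<le> Suc L ^ CARD('m)"
      by (intro power_mono) (auto simp: L'_def)
    finally show "real (card A) \<le> real (Suc L) ^ CARD('m)"
      by (metis of_nat_le_iff of_nat_power)
    \<comment> \<open>Subtraction is truncated, but \<open>4 * CARD('m option) + L' \<ge> L\<close>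
      holds in either case.\<close>
    have "(1/2 :: real) ^ L' = 2 ^ (4 * CARD('m option)) * (1/2) ^ (4 * CARD('m option) + L')"
      by (simp add: power_add power_divide)
    also have "(1/2 :: real) ^ (4 * CARD('m option) + L') \<le> (1/2) ^ L"
      by (intro power_decreasing) (auto simp: L'_def)
    finally show "(1/2 :: real) ^ L' \<le> 2 ^ (4 * CARD('m option)) * (1/2) ^ L"
      by simp
  qed (use \<open>E \<ge> 0\<close> in auto)
  finally show ?thesis .
qed

section \<open>Choice of the scale L for each n, and Borel-Cantelli\<close>

lemma exp_neg_powr_le_powr_neg:
  fixes a \<eta> s :: real
  assumes "a > 0" "\<eta> > 0" "s > 0"
  shows "\<forall>\<^sub>F n::nat in sequentially. exp (- (a * real n powr \<eta>)\<^sup>2 / 2) \<le> real n powr - s"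
  using assms by real_asymp

lemma measure_approx_set_asymp:
  fixes \<alpha> :: "real ^ 'm::finite" and y :: "real ^ 'm option" and \<psi> :: "nat \<Rightarrow> real"
  assumes \<psi>: "\<And>n. n \<ge> 1 \<Longrightarrow> 0 \<le> \<psi> n \<and> \<psi> n < 1"
    and l: "l = 1 + card {i. \<alpha> $ i \<noteq> 0}"
    and \<alpha>: "simult_exponent \<alpha> < ereal (real l)"
  shows "\<exists>C e. e > 0 \<and> (\<forall>\<^sub>F n in sequentially. measure vec_normal (approx_set \<alpha> c y n (\<psi> n))
    \<le> C * (ln (real n) ^ CARD('m) * (\<psi> n + real n powr - (1 + e))))"
proof -
  obtain w0 where w0: "simult_exponent \<alpha> < ereal w0" "w0 < real l"
    using ereal_dense2[OF \<alpha>] by auto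
  \<comment> \<open>\<^term>\<open>w0\<close> need not be positive a priori.\<close>
  define w where "w = max w0 (1/2)"
  have w: "simult_exponent \<alpha> < ereal w" "0 < w" "w < real l"
    using w0 l by (auto simp: w_def max_def less_trans intro: less_le_trans)
  \<comment> \<open>Taking for e half of the gap \<open>l / w - 1\<close> makes
    \<open>(1 + e) * w / l\<close> the midpoint of \<open>w / l\<close> and 1; \<eta> is its
    distance to 1.\<close>
  define \<eta> where "\<eta> = (real l - w) / (2 * real l)"
  define e where "e = (real l / w - 1) / 2"
  have "l > 0" by (simp add: l)
  have pos: "\<eta> > 0" "e > 0"
    using w by (auto simp: \<eta>_def e_def field_simps)
  have \<eta>_eq: "1 + (1 + e) * (- w / real l) = \<eta>"
    using w \<open>l > 0\<close> by (simp add: \<eta>_def e_def field_simps)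
  obtain \<kappa> where \<kappa>: "\<kappa> > 0" "\<And>(N :: 'm option \<Rightarrow> nat) (d :: 'm option \<Rightarrow> int) X.
    \<forall>i. N i \<ge> 1 \<Longrightarrow> real (\<Prod>i\<in>UNIV. N i) \<le> X \<Longrightarrow> \<forall>i. \<bar>d i\<bar> < int (N i) \<Longrightarrow> d \<noteq> (\<lambda>_. 0 :: int) \<Longrightarrow>
      (\<kappa> * X powr (- w / l))\<^sup>2 \<le> (\<Sum>j\<in>UNIV. (d (Some j) - d None * \<alpha> $ j)\<^sup>2)"
    using linear_forms_lower_bound[OF w(1,2) l] by blast
  define C0 where "C0 = 1 + (1 + e) / ln 2"
  define K where "K = CARD('m option)"
  define C where "C = C0 ^ CARD('m) * (2 ^ K * (2 ^ (4 * K) * 2 + 1))"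
  have "C0 > 0" using pos by (auto simp: C0_def intro!: add_pos_nonneg)
  have decay: "\<forall>\<^sub>F n::nat in sequentially.
      exp (- ((2 * pi * \<kappa>) * real n powr \<eta>)\<^sup>2 / 2) \<le> real n powr - (1 + e)"
    using \<kappa>(1) pos by (intro exp_neg_powr_le_powr_neg) auto
  have "\<forall>\<^sub>F n in sequentially. measure vec_normal (approx_set \<alpha> c y n (\<psi> n))
    \<le> C * (ln (real n) ^ CARD('m) * (\<psi> n + real n powr - (1 + e)))"
    \<comment> \<open>From n \<ge> 3 on, \<open>ln n \<ge> 1\<close>, which lets the additive
      constant in \<open>Suc L\<close> be absorbed into \<open>C0\<close>.\<close>
    using decay eventually_ge_at_top[of 3]
  proof eventually_elim
    case (elim n)
    define X where "X = real n powr (1 + e)"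
    define E where "E = exp (- ((2 * pi * \<kappa>) * real n powr \<eta>)\<^sup>2 / 2)"
    \<comment> \<open>Raising \<psi> to at least \<open>n powr - (1 + e)\<close> ensures
      \<open>2 ^ L \<le> 1 / q \<le> X\<close>, the range in which the linear forms stay above a
      multiple of \<open>n powr (\<eta> - 1)\<close>.\<close>
    define q where "q = max (\<psi> n) (real n powr - (1 + e))"
    define L where "L = nat \<lfloor>log 2 (1 / q)\<rfloor>"
    have "X > 0" using elim by (simp add: X_def)
    have q: "0 < q" "q \<le> 1" "\<psi> n \<le> q" "real n powr - (1 + e) \<le> q" "q \<le> \<psi> n + real n powr - (1 + e)"
    proof -
      have "0 < real n powr - (1 + e)" using elim by simp
      moreover have "real n powr - (1 + e) \<le> real n powr 0"
        using elim pos by (intro powr_mono) auto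
      moreover have "0 \<le> \<psi> n" "\<psi> n < 1"
        using \<psi>[of n] elim by auto
      ultimately show "0 < q" "q \<le> 1" "\<psi> n \<le> q" "real n powr - (1 + e) \<le> q" "q \<le> \<psi> n + real n powr - (1 + e)"
        using elim by (auto simp: q_def less_max_iff_disj)
    qed
    have qX: "1 / q \<le> X"
    proof -
      have "1 / q \<le> 1 / real n powr - (1 + e)"
        using q elim by (intro divide_left_mono) auto
      also have "\<dots> = X" by (simp only: X_def powr_minus_divide) simp
      finally show ?thesis .
    qed
    have log_nonneg: "0 \<le> log 2 (1 / q)"
      using q by (simp add: zero_le_log_cancel_iff)
    then have L: "real L \<le> log 2 (1 / q)" "log 2 (1 / q) < real L + 1"
      unfolding L_def by linarith+
    have L1: "2 ^ L \<le> 1 / q"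
      using L(1) q by (simp add: le_log_iff powr_realpow)
    have L2: "1 / q < 2 * 2 ^ L"
    proof -
      have "1 / q < 2 powr (real L + 1)"
        using L(2) q by (subst (asm) log_less_iff) auto
      then show ?thesis by (simp add: powr_add powr_realpow mult.commute)
    qed
    have half: "q \<le> (1/2) ^ L" "(1/2) ^ L \<le> 2 * q"
      using L1 L2 q by (auto simp: power_divide field_simps)
    have "1 \<le> ln (real n)"
    proof -
      have "ln (exp 1) \<le> ln (real n)"
        using elim exp_le by (subst ln_le_cancel_iff) auto
      then show ?thesis by simp
    qed
    have SucL: "real (Suc L) \<le> C0 * ln (real n)"
    proof -
      have "real L \<le> log 2 X"
        using L(1) qX q \<open>X > 0\<close> by (intro order_trans[OF L(1)]) (simp add: log_le_cancel_iff)
      also have "\<dots> = (1 + e) / ln 2 * ln (real n)"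
        using elim by (simp add: X_def log_def ln_powr)
      finally show ?thesis
        using \<open>1 \<le> ln (real n)\<close> by (simp add: C0_def algebra_simps)
    qed
    have "measure vec_normal (approx_set \<alpha> c y n (\<psi> n))
        \<le> real (Suc L) ^ CARD('m) * (2 ^ K * (2 ^ (4 * K) * (1/2) ^ L + E))"
      unfolding K_def
    proof (rule measure_approx_set_le)
      show "\<psi> n \<le> (1/2) ^ L" using q half by linarith
      show "E \<ge> 0" by (simp add: E_def)
      fix m :: "'m option \<Rightarrow> nat" and d :: "'m option \<Rightarrow> int"
      assume m: "sum m UNIV \<le> L" and d: "\<And>i. \<bar>d i\<bar> < (2 :: int) ^ m i" "d \<noteq> (\<lambda>_. 0 :: int)"
      let ?e = "\<lambda>j. d (Some j) - d None * \<alpha> $ j"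
      have "(\<kappa> * X powr (- w / l))\<^sup>2 \<le> (\<Sum>j\<in>UNIV. (?e j)\<^sup>2)"
      proof (rule \<kappa>(2)[of "\<lambda>i. 2 ^ m i"])
        have "real (\<Prod>i\<in>UNIV. 2 ^ m i) = 2 ^ sum m UNIV"
          by (simp add: power_sum)
        also have "\<dots> \<le> 2 ^ L" using m by (intro power_increasing) auto
        also have "\<dots> \<le> X" using L1 qX by linarith
        finally show "real (\<Prod>i\<in>UNIV. 2 ^ m i) \<le> X" .
      qed (use d in auto)
      then have "(2 * pi * real n)\<^sup>2 * (\<kappa> * X powr (- w / l))\<^sup>2 \<le> (2 * pi * real n)\<^sup>2 * (\<Sum>j\<in>UNIV. (?e j)\<^sup>2)"
        by (intro mult_left_mono) auto
      also have "(2 * pi * real n)\<^sup>2 * (\<Sum>j\<in>UNIV. (?e j)\<^sup>2) = (\<Sum>j\<in>UNIV. (2 * pi * real n * ?e j)\<^sup>2)"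
        by (simp only: sum_distrib_left power_mult_distrib)
      also have "(2 * pi * real n)\<^sup>2 * (\<kappa> * X powr (- w / l))\<^sup>2
          = (2 * pi * \<kappa> * (real n powr 1 * real n powr ((1 + e) * (- w / l))))\<^sup>2"
        using elim by (simp add: X_def powr_powr power_mult_distrib)
      also have "real n powr 1 * real n powr ((1 + e) * (- w / l)) = real n powr \<eta>"
        by (simp only: powr_add[symmetric] \<eta>_eq)
      finally show "exp (- (\<Sum>j\<in>UNIV. (2 * pi * real n * ?e j)\<^sup>2) / 2) \<le> E"
        by (simp add: E_def)
    qed
    \<comment> \<open>The Gaussian error satisfies \<open>E \<le> n powr - (1 + e) \<le> q\<close>,
      so it is no larger than the main term's order.\<close>
    also have "\<dots> \<le> (C0 * ln (real n)) ^ CARD('m) * (2 ^ K * (2 ^ (4 * K) * (2 * q) + q))"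
      using SucL half elim q unfolding E_def[symmetric]
      by (intro mult_mono power_mono add_mono order_refl) (auto simp: E_def)
    also have "\<dots> = C * (ln (real n) ^ CARD('m) * q)"
      by (simp add: C_def power_mult_distrib algebra_simps)
    also have "\<dots> \<le> C * (ln (real n) ^ CARD('m) * (\<psi> n + real n powr - (1 + e)))"
      using q \<open>1 \<le> ln (real n)\<close> \<open>C0 > 0\<close> by (intro mult_left_mono) (auto simp: C_def)
    finally show ?case .
  qed
  with pos(2) show ?thesis by blast
qed

lemma AE_finitely_many_approx_set:
  fixes \<alpha> :: "real ^ 'm::finite" and y :: "real ^ 'm option" and \<psi> :: "nat \<Rightarrow> real"
  assumes \<psi>: "\<And>n. n \<ge> 1 \<Longrightarrow> 0 \<le> \<psi> n \<and> \<psi> n < 1"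
    and sum: "summable (\<lambda>n. \<psi> n * ln (real n) ^ CARD('m))"
    and l: "l = 1 + card {i. \<alpha> $ i \<noteq> 0}"
    and \<alpha>: "simult_exponent \<alpha> < ereal (real l)"
  shows "AE u in lborel. \<forall>\<^sub>F n in sequentially. u \<notin> approx_set \<alpha> c y n (\<psi> n)"
proof -
  interpret prob_space "vec_normal :: (real ^ 'm) measure"
    by (rule prob_space_vec_normal)
  obtain C e where e: "e > 0" and bound: "\<forall>\<^sub>F n in sequentially.
      measure vec_normal (approx_set \<alpha> c y n (\<psi> n)) \<le> C * (ln (real n) ^ CARD('m) * (\<psi> n + real n powr - (1 + e)))"
    using measure_approx_set_asymp[of \<psi> l \<alpha> c y] \<psi> l \<alpha> by blast
  have "summable (\<lambda>n. ln (real n) ^ CARD('m) * real n powr - (1 + e))"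
  proof (rule summable_comparison_test_ev)
    \<comment> \<open>Half of e absorbs the power of the logarithm, the other half keeps the series
      convergent.\<close>
    show "summable (\<lambda>n. real n powr - (1 + e / 2))"
      using e by (simp add: summable_real_powr_iff)
    have "\<forall>\<^sub>F n::nat in sequentially. ln (real n) ^ CARD('m) * real n powr - (1 + e) \<le> real n powr - (1 + e / 2)"
      using e by real_asymp
    then show "\<forall>\<^sub>F n in sequentially. norm (ln (real n) ^ CARD('m) * real n powr - (1 + e)) \<le> real n powr - (1 + e / 2)"
      using eventually_ge_at_top[of 1] by eventually_elim (simp add: abs_mult)
  qed
  with sum have "summable (\<lambda>n. C * (\<psi> n * ln (real n) ^ CARD('m) + ln (real n) ^ CARD('m) * real n powr - (1 + e)))"
    by (intro summable_mult summable_add)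
  moreover have "\<forall>\<^sub>F n in sequentially. norm (measure vec_normal (approx_set \<alpha> c y n (\<psi> n))) \<le>
      C * (\<psi> n * ln (real n) ^ CARD('m) + ln (real n) ^ CARD('m) * real n powr - (1 + e))"
    using bound by eventually_elim (simp add: algebra_simps)
  ultimately have "summable (\<lambda>n. measure vec_normal (approx_set \<alpha> c y n (\<psi> n)))"
    by (rule summable_comparison_test_ev[rotated])
  then have "AE u in vec_normal. \<forall>\<^sub>F n in sequentially. u \<in> space vec_normal - approx_set \<alpha> c y n (\<psi> n)"
    by (intro borel_cantelli_AE1) (auto simp: emeasure_eq_measure)
  then show ?thesis
    by (simp add: AE_vec_normal_iff)
qed

subsection \<open>Transfer to the hyperplane\<close>

lemma continuous_on_hyperplane_param: "continuous_on S (hyperplane_param \<alpha> c)"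
  unfolding hyperplane_param_def
proof (rule continuous_on_vec_lambda)
  fix i
  show "continuous_on S (\<lambda>u. case i of None \<Rightarrow> c - \<alpha> \<bullet> u | Some j \<Rightarrow> u $ j)"
    by (cases i) (auto intro!: continuous_intros)
qed

lemma hyperplane_param_mem: "normal_vec \<alpha> \<bullet> hyperplane_param \<alpha> c u = c"
  by (simp add: inner_vec_def[of "normal_vec \<alpha>"] sum_UNIV_option normal_vec_def hyperplane_param_def)
     (simp add: inner_vec_def sum_UNIV_option)

lemma hyperplane_param_of_mem:
  assumes "normal_vec \<alpha> \<bullet> x = c"
  shows "hyperplane_param \<alpha> c (\<chi> j. x $ Some j) = x"
proof -
  have "c = x $ None + \<alpha> \<bullet> (\<chi> j. x $ Some j)"
    using assms by (simp add: inner_vec_def sum_UNIV_option normal_vec_def)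
  then show ?thesis
    by (auto simp: hyperplane_param_def vec_eq_iff split: option.split)
qed

text \<open>Cauchy-Schwarz controls the first coordinate; the others are copied. The Lipschitz bound
  is what carries null sets over to the hyperplane.\<close>

lemma dist_hyperplane_param_le:
  "dist (hyperplane_param \<alpha> c u) (hyperplane_param \<alpha> c v) \<le> (norm \<alpha> + 1) * dist u v"
proof -
  define z where "z = u - v"
  have eq: "hyperplane_param \<alpha> c u - hyperplane_param \<alpha> c v =
      axis None (- (\<alpha> \<bullet> z)) + (\<chi> i. case i of None \<Rightarrow> 0 | Some j \<Rightarrow> z $ j)"
    by (auto simp: vec_eq_iff hyperplane_param_def z_def axis_def inner_diff_right split: option.split)
  have "norm (\<chi> i. case i of None \<Rightarrow> 0 | Some j \<Rightarrow> z $ j) = norm z"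
    by (simp add: norm_vec_def L2_set_def sum_UNIV_option)
  moreover have "norm (axis None (- (\<alpha> \<bullet> z)) :: real ^ 'a option) \<le> norm \<alpha> * norm z"
  proof -
    have "norm (axis None a :: real ^ 'a option) = \<bar>a\<bar>" for a
      by (simp add: norm_vec_def L2_set_def sum_UNIV_option axis_def)
    then show ?thesis by (simp add: Cauchy_Schwarz_ineq2)
  qed
  ultimately show ?thesis
    unfolding dist_norm eq z_def[symmetric]
    by (intro order_trans[OF norm_triangle_ineq]) (simp add: algebra_simps)
qed

theorem mainTheorem3:
  fixes k :: nat
    and \<alpha> :: "real ^ 'm::finite"
    and H :: "(real ^ 'm option) set"
    and c :: real
    and \<psi> :: "nat \<Rightarrow> real"
    and y :: "real ^ 'm option"
    and l :: nat
  assumes "k \<ge> 2" and "CARD('m option) = k"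
    and "H = {x. normal_vec \<alpha> \<bullet> x = c}"
    and "\<forall>n\<ge>1. 0 \<le> \<psi> n \<and> \<psi> n < 1"
    and "summable (\<lambda>n. \<psi> n * ln (real n) ^ (k - 1))"
    and "l = 1 + card {i. \<alpha> $ i \<noteq> 0}"
    and "simult_exponent \<alpha> < ereal (real l)"
  shows "W_mult \<psi> y \<in> null_sets (induced_prob H)"
proof -
  have k: "k - 1 = CARD('m)"
    using assms(2) by (simp add: card_UNIV_option)
  have "normal_vec \<alpha> $ None \<noteq> 0"
    by (simp add: normal_vec_def)
  then have "normal_vec \<alpha> \<noteq> 0"
    by (metis zero_index)
  then obtain f :: "real ^ 'm \<Rightarrow> real ^ 'm option"
    where f: "range f = H" "\<And>u v. dist (f u) (f v) = dist u v"
    using ex_hyperplane_isometry[of "normal_vec \<alpha>" c] assms(3) by auto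
  have [measurable]: "f \<in> borel_measurable borel"
    using f(2) by (rule isometry_borel_measurable)
  have W [measurable]: "W_mult \<psi> y \<in> sets borel"
    unfolding W_mult_def INFM_nat_le by measurable
  have H [measurable]: "H \<in> sets borel"
    unfolding assms(3) by (intro borel_closed closed_hyperplane)
  define p where "p = hyperplane_param \<alpha> c"
  have [measurable]: "p \<in> borel_measurable borel"
    unfolding p_def by (rule borel_measurable_continuous_onI[OF continuous_on_hyperplane_param])
  define Z where "Z = {u. p u \<in> W_mult \<psi> y}"
  have [measurable]: "Z \<in> sets borel"
    unfolding Z_def by measurable
  have "AE u in lborel. \<forall>\<^sub>F n in sequentially. u \<notin> approx_set \<alpha> c y n (\<psi> n)"
    using assms(4-7) k by (intro AE_finitely_many_approx_set) auto
  then have "AE u in lborel. u \<notin> Z"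
  proof eventually_elim
    case (elim u)
    moreover have "\<exists>\<^sub>\<infinity>n. u \<in> approx_set \<alpha> c y n (\<psi> n)" if "u \<in> Z"
      using that by (auto simp: Z_def W_mult_def approx_set_def p_def elim!: INFM_mono)
    ultimately show ?case
      by (auto simp: frequently_def cofinite_eq_sequentially)
  qed
  then have "emeasure lborel Z = 0"
    by (subst (asm) AE_iff_measurable[OF _ refl]) auto
  then have "negligible Z"
    by (auto simp: negligible_iff_null_sets null_sets_completion_iff null_sets_def)
  \<comment> \<open>g changes from graph coordinates to those of the isometry f. As f preserves
    distances, g inherits the Lipschitz bound and maps null sets to null sets, without any
    Jacobian.\<close>
  define g where "g = (\<lambda>u. inv f (p u))"
  have fg: "f (g u) = p u" for u
    unfolding g_def using f(1) assms(3) hyperplane_param_mem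
    by (intro f_inv_into_f) (auto simp: p_def)
  have "negligible (g ` Z)"
  proof (rule negligible_locally_Lipschitz_image[OF _ \<open>negligible Z\<close>])
    fix u assume "u \<in> Z"
    have "norm (g v - g u) \<le> (norm \<alpha> + 1) * norm (v - u)" for v
      using dist_hyperplane_param_le[of \<alpha> c v u] f(2)[of "g v" "g u"] fg
      by (simp add: p_def dist_norm)
    then show "\<exists>U B. open U \<and> u \<in> U \<and> (\<forall>v\<in>Z \<inter> U. norm (g v - g u) \<le> B * norm (v - u))"
      by (intro exI[of _ UNIV] exI[of _ "norm \<alpha> + 1"]) auto
  qed simp
  moreover have "f -` (H \<inter> unit_cube \<inter> W_mult \<psi> y) \<subseteq> g ` Z"
  proof
    fix v assume "v \<in> f -` (H \<inter> unit_cube \<inter> W_mult \<psi> y)"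
    then have v: "f v \<in> H" "f v \<in> W_mult \<psi> y" by auto
    define u where "u = (\<chi> j. f v $ Some j)"
    have pu: "p u = f v"
      using v(1) assms(3) by (simp add: p_def u_def hyperplane_param_of_mem)
    \<comment> \<open>An isometry is injective: \<open>f (g u) = f v\<close> forces
      \<open>g u = v\<close>.\<close>
    then have "dist (g u) v = 0"
      using f(2)[of "g u" v] fg[of u] by simp
    then show "v \<in> g ` Z"
      using v(2) pu by (intro image_eqI[of _ _ u]) (auto simp: Z_def)
  qed
  ultimately have "negligible (f -` (H \<inter> unit_cube \<inter> W_mult \<psi> y))"
    by (rule negligible_subset)
  moreover have "f -` (H \<inter> unit_cube \<inter> W_mult \<psi> y) \<in> sets borel"
    using measurable_sets[of f borel borel "H \<inter> unit_cube \<inter> W_mult \<psi> y"] by simp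
  ultimately have "emeasure lborel (f -` (H \<inter> unit_cube \<inter> W_mult \<psi> y)) = 0"
    by (auto simp: negligible_iff_null_sets null_sets_completion_iff)
  then have "emeasure (hyperplane_lborel H) (H \<inter> unit_cube \<inter> W_mult \<psi> y) = 0"
    by (simp add: hyperplane_lborel_eq[OF f] emeasure_distr)
  moreover have "sets (hyperplane_lborel H) = sets borel"
    by (simp add: hyperplane_lborel_def)
  \<comment> \<open>The uniform measure is a quotient with numerator 0; in \<open>ennreal\<close> it
    is 0 even if the denominator is 0.\<close>
  ultimately show ?thesis
    by (simp add: null_sets_def induced_prob_def)
qed

end
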